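(* (a) For each fixed $A>0$ and all $x \geq 3$, the number of additive endpoints in $[1,x]$ is $\ll_A x/(\log x)^A$. (b) There is an absolute constant $c_5>0$ such that for all sufficiently large $x$, the number of additive endpoints in $[1,x]$ exceeds $x/\exp(c_5(\log\log x)^3)$.
   Context: For a natural number $n$, let $f(n)$ be the largest integer such that every integer in $\{1,2,\dots,f(n)\}$ can be written as a sum of distinct (positive) divisors of $n$. A natural number $m$ is called an additive endpoint if $m = f(n)$ for some natural number $n$. The notation $\ll_A$ means the inequality holds up to a multiplicative constant depending only on $A$. *)

theory Defs
  imports Complex_Main
begin

definition sum_of_distinct_divisors :: "nat \<Rightarrow> nat \<Rightarrow> bool" where
  "sum_of_distinct_divisors n k \<longleftrightarrow> (\<exists>D. D \<subseteq> {d. d dvd n} \<and> finite D \<and> k = \<Sum>D)"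

definition divisor_sum_reach :: "nat \<Rightarrow> nat" where
  "divisor_sum_reach n = (GREATEST m. \<forall>k\<in>{1..m}. sum_of_distinct_divisors n k)"

definition additive_endpoint :: "nat \<Rightarrow> bool" where
  "additive_endpoint m \<longleftrightarrow> (\<exists>n>0. m = divisor_sum_reach n)"

text \<open>For positive \<open>n\<close> the maximum defining \<open>divisor_sum_reach n\<close> is attained,
  since sums of distinct divisors are bounded by the sum of all divisors.\<close>

lemma divisor_sum_reach:
  assumes "n > 0"
  shows "\<forall>k\<in>{1..divisor_sum_reach n}. sum_of_distinct_divisors n k"
    and "(\<forall>k\<in>{1..m}. sum_of_distinct_divisors n k) \<Longrightarrow> m \<le> divisor_sum_reach n"
proof -
  let ?P = "\<lambda>m. \<forall>k\<in>{1..m}. sum_of_distinct_divisors n k"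
  have fin: "finite {d. d dvd n}"
    using assms by simp
  have bound: "m \<le> \<Sum>{d. d dvd n}" if "?P m" for m
  proof (cases "m = 0")
    case False
    then have "sum_of_distinct_divisors n m"
      using that by simp
    then show ?thesis
      unfolding sum_of_distinct_divisors_def using fin by (auto intro: sum_mono2)
  qed simp
  have "?P 0"
    by simp
  then show "?P (divisor_sum_reach n)"
    unfolding divisor_sum_reach_def by (rule GreatestI_nat) (use bound in blast)
  show "m \<le> divisor_sum_reach n" if "?P m"
    unfolding divisor_sum_reach_def
    by (rule Greatest_le_nat[where P = ?P, OF that]) (use bound in blast)
qed

end

theory Submission
  imports Defs "HOL-Analysis.Analysis" "HOL-Number_Theory.Cong" "HOL-Real_Asymp.Real_Asymp"
begin

text \<open>
  The additive endpoints are exactly the values \<open>\<sigma>(m)\<close> with \<open>m\<close> practical, where \<open>m\<close> arises from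
  \<open>1\<close> by successively adjoining prime powers \<open>p\<^sup>e\<close> with \<open>p \<le> \<sigma>(n) + 1\<close>.

  Upper bound: a practical \<open>m > \<surd>x\<close> without large square divisors has at least a constant times
  \<open>log log x\<close> simple prime factors, because adjoining a prime at most cubes the number. Brun's
  pure sieve shows that \<open>\<Sum> 2\<^bsup>- \<omega>(p + 1)\<^esup> / p\<close> converges, so by Rankin's trick, for all but
  \<open>O(x / (log x)\<^sup>A)\<close> such \<open>m\<close>, the value \<open>\<sigma>(m)\<close>, a multiple of \<open>\<Prod> (p + 1)\<close> over the simple
  prime factors, has more than \<open>C log log x\<close> prime factors; and few integers up to \<open>x\<close> have that
  many.

  Lower bound: the numbers \<open>m = 2\<^sup>r p\<^sub>0 \<cdots> p\<^sub>J\<^sub>-\<^sub>1\<close> with \<open>p\<^sub>j\<close> slightly below \<open>B\<close> to the power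
  \<open>2\<^sup>j\<close>, where \<open>J\<close> is of order \<open>log log x\<close>, are practical, and Chebyshev's bound provides many
  of them. The number of ways to write \<open>v\<close> as \<open>\<Prod> (p\<^sub>j + 1)\<close> is at most the number \<open>\<tau>\<^sub>J(v)\<close> of
  ordered factorizations into \<open>J\<close> factors, whose second moment up to \<open>x\<close> is at most \<open>x\<close> times the
  \<open>J\<^sup>2\<close>-th power of \<open>1 + log x\<close>. The Cauchy-Schwarz inequality then bounds the number of distinct
  values from below.
\<close>

section \<open>Additive endpoints and practical numbers\<close>

text \<open>Neither bound follows from counting \<open>m\<close> alone: a typical integer up to
  \<open>x\<close> already has about \<open>log log x\<close> prime factors, and distinct
  \<open>m\<close> may share one value of \<open>divsum\<close>. In the upper bound the rare event
  is that many simple primes of \<open>m\<close> produce a value with few prime factors. The weight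
  \<open>2^(-omega(p + 1))\<close> measures this. Sieving by a prime \<open>q\<close> removes
  density \<open>1/q\<close> for \<open>q dvd p\<close> and half of \<open>1/q\<close> for
  \<open>q dvd p + 1\<close>, so the weighted density of primes near \<open>y\<close> is about
  \<open>(log y)^(-3/2)\<close>. Any exponent above 1 makes the weighted sum of \<open>1/p\<close>
  converge, whereas the unweighted one diverges; the slack between 1 and 3/2 is what makes the crude
  pure sieve sufficient. In the lower bound the cube comes from the second moment:
  \<open>J^2\<close> factors \<open>1 + log x\<close> with \<open>J\<close> of order
  \<open>log log x\<close>. All other losses are \<open>exp (O((log log x)^2))\<close>.\<close>

definition divsum :: "nat \<Rightarrow> nat" where
  "divsum n = \<Sum>{d. d dvd n}"

lemma divsum_1 [simp]: "divsum (Suc 0) = 1"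
  by (simp add: divsum_def)

lemma gcd_mult_distrib_coprime:
  fixes a b d :: nat
  assumes "coprime a b"
  shows "gcd (a * b) d = gcd a d * gcd b d"
proof (rule dvd_antisym)
  show "gcd (a * b) d dvd gcd a d * gcd b d"
  proof -
    let ?g = "gcd (a * b) d"
    have "?g dvd gcd (b * a) (b * d)" "?g dvd gcd (d * a) (d * d)"
      by (auto simp: mult.commute[of b a])
    then have "?g dvd gcd (gcd a d * b) (gcd a d * d)"
      by (simp add: gcd_mult_distrib_nat mult.commute[of "gcd a d"])
    then show ?thesis
      by (simp add: gcd_mult_distrib_nat)
  qed
  have "coprime (gcd a d) (gcd b d)"
    using assms by (meson coprime_divisors gcd_dvd1)
  then show "gcd a d * gcd b d dvd gcd (a * b) d"
    by (intro gcd_greatest mult_dvd_mono) (auto intro: divides_mult)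
qed

lemma divisors_coprime_mult:
  fixes a b :: nat
  assumes "coprime a b"
  shows "bij_betw (\<lambda>(d, e). d * e) ({d. d dvd a} \<times> {e. e dvd b}) {d. d dvd a * b}"
proof (rule bij_betwI[where g = "\<lambda>d. (gcd d a, gcd d b)"])
  show "(\<lambda>(d, e). d * e) \<in> {d. d dvd a} \<times> {e. e dvd b} \<rightarrow> {d. d dvd a * b}"
    by (auto intro: mult_dvd_mono)
  show "(\<lambda>d. (gcd d a, gcd d b)) \<in> {d. d dvd a * b} \<rightarrow> {d. d dvd a} \<times> {e. e dvd b}"
    by auto
  show "(case (gcd d a, gcd d b) of (d, e) \<Rightarrow> d * e) = d" if "d \<in> {d. d dvd a * b}" for d
  proof -
    have "gcd d (a * b) = gcd d a * gcd d b"
      using assms by (metis gcd.commute gcd_mult_distrib_coprime)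
    with that show ?thesis
      by (simp add: gcd_nat.absorb1)
  qed
  show "(gcd (case x of (d, e) \<Rightarrow> d * e) a, gcd (case x of (d, e) \<Rightarrow> d * e) b) = x"
    if x': "x \<in> {d. d dvd a} \<times> {e. e dvd b}" for x
  proof -
    obtain d e where x: "x = (d, e)" "d dvd a" "e dvd b" using x' by blast
    have "coprime e a" "coprime d b"
      using assms x by (meson coprime_commute coprime_divisors dvd_refl)+
    then show ?thesis
      using x by (simp add: gcd_mult_right_left_cancel gcd_mult_left_left_cancel gcd_nat.absorb1
          gcd_mult_left_right_cancel gcd_mult_right_right_cancel coprime_commute)
  qed
qed

lemma divsum_coprime_mult:
  assumes "coprime a b"
  shows "divsum (a * b) = divsum a * divsum b"
proof -
  have "divsum (a * b) = (\<Sum>(d, e)\<in>{d. d dvd a} \<times> {e. e dvd b}. d * e)"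
    unfolding divsum_def
    by (subst sum.reindex_bij_betw[OF divisors_coprime_mult[OF assms], symmetric])
       (simp add: case_prod_unfold)
  then show ?thesis
    by (simp add: divsum_def sum_product sum.cartesian_product)
qed

lemma divsum_prime_power:
  assumes "prime p"
  shows "divsum (p ^ e) = (\<Sum>i\<le>e. p ^ i)"
proof -
  have "{d. d dvd p ^ e} = (\<lambda>i. p ^ i) ` {..e}"
    using assms by (auto simp: divides_primepow_nat)
  moreover have "inj_on (\<lambda>i. p ^ i) {..e}"
    using assms prime_gt_1_nat by (auto simp: inj_on_def)
  ultimately show ?thesis
    by (simp add: divsum_def sum.reindex)
qed

lemma divsum_prime: "prime p \<Longrightarrow> divsum p = p + 1"
  using divsum_prime_power[of p 1] by simp

text \<open>The new divisors are those of \<open>n\<close> times \<open>p ^ Suc e\<close>. This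
  recursion drives the inductions on the exponent below.\<close>

lemma divsum_mult_prime_power_Suc:
  assumes "prime p" "\<not> p dvd n"
  shows "divsum (n * p ^ Suc e) = divsum (n * p ^ e) + p ^ Suc e * divsum n"
proof -
  have cop: "coprime n (p ^ f)" for f
    using assms by (metis coprime_commute coprime_power_right_iff prime_imp_coprime)
  show ?thesis
    unfolding divsum_coprime_mult[OF cop] divsum_prime_power[OF assms(1)]
    by (simp add: algebra_simps)
qed

lemma divsum_ge: "n > 0 \<Longrightarrow> divsum n \<ge> n"
  unfolding divsum_def by (rule member_le_sum) auto

lemma divsum_pos: "n > 0 \<Longrightarrow> divsum n > 0"
  using divsum_ge[of n] by simp

text \<open>Combined with \<open>p <= divsum n + 1\<close> this gives
  \<open>2 * n * p <= (2 * n) ^ 3\<close>, the sense in which a new simple prime at most cubes the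
  number; the factor 2 is carried along so that the inequality can be iterated.\<close>

lemma divsum_le_square:
  assumes "n > 0"
  shows "divsum n + 1 \<le> 2 * n ^ 2"
proof (cases "n = 1")
  case False
  have "divsum n \<le> \<Sum>{1..n}"
    unfolding divsum_def using assms by (intro sum_mono2) (auto dest: dvd_imp_le)
  also have "\<dots> \<le> (\<Sum>i\<in>{1..n}. n)"
    by (rule sum_mono) simp
  also have "\<dots> = n ^ 2" by (simp add: power2_eq_square)
  finally show ?thesis
    using one_le_power[of n 2] assms by linarith
qed simp

text \<open>The primes may be adjoined in any order: only \<open>p\<close> not dividing \<open>n\<close> is required, so the ordering
  of the prime factors never enters.\<close>
inductive chain_practical :: "nat \<Rightarrow> bool" where
  one: "chain_practical 1"
| step: "chain_practical n \<Longrightarrow> prime p \<Longrightarrow> \<not> p dvd n \<Longrightarrow> p \<le> divsum n + 1 \<Longrightarrow> e > 0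
    \<Longrightarrow> chain_practical (n * p ^ e)"

lemma chain_practical_pos: "chain_practical n \<Longrightarrow> n > 0"
  by (induction rule: chain_practical.induct) (auto simp: prime_gt_0_nat)

section \<open>Representing every integer up to the divisor sum\<close>

lemma sum_of_distinct_divisors_mono:
  assumes "sum_of_distinct_divisors m k" "m dvd n"
  shows "sum_of_distinct_divisors n k"
  using assms unfolding sum_of_distinct_divisors_def by (blast intro: dvd_trans)

text \<open>Write \<open>k\<close> as \<open>j * p ^ Suc e\<close> plus a remainder, with
  \<open>j <= divsum n\<close> and the remainder at most \<open>divsum (n * p ^ e)\<close>. Divisors
  of \<open>n\<close> summing to \<open>j\<close>, multiplied by \<open>p ^ Suc e\<close>, do not
  divide \<open>n * p ^ e\<close>, so they never collide with the divisors used for the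
  remainder.\<close>

lemma sum_of_distinct_divisors_step:
  assumes IH: "\<forall>k\<le>divsum (n * p ^ e). sum_of_distinct_divisors (n * p ^ e) k"
    and n: "\<forall>k\<le>divsum n. sum_of_distinct_divisors n k" "n > 0"
    and p: "prime p" "\<not> p dvd n" "p \<le> divsum n + 1"
  shows "\<forall>k\<le>divsum (n * p ^ Suc e). sum_of_distinct_divisors (n * p ^ Suc e) k"
proof (intro allI impI)
  fix k assume k: "k \<le> divsum (n * p ^ Suc e)"
  let ?q = "p ^ Suc e"
  have q0: "?q > 0" using p by (simp add: prime_gt_0_nat)
  \<comment> \<open>Every remainder modulo \<open>?q\<close> is then at most
    \<open>divsum (n * p ^ e)\<close>, hence covered by the induction hypothesis.\<close>
  have q_le: "?q \<le> divsum (n * p ^ e) + 1"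
  proof (cases e)
    case 0
    then show ?thesis using p by simp
  next
    case (Suc e')
    have *: "\<exists>t. divsum (n * p ^ f) + 1 = p ^ Suc f + t" for f
    proof (induction f)
      case 0
      then show ?case using p(3) by (auto simp: le_iff_add)
    next
      case (Suc f)
      then obtain t where t: "divsum (n * p ^ f) + 1 = p ^ Suc f + t" by blast
      have "p ^ Suc (Suc f) = p * p ^ Suc f" by simp
      also have "\<dots> \<le> (divsum n + 1) * p ^ Suc f" using p(3) by (rule mult_le_mono1)
      also have "\<dots> = p ^ Suc f * divsum n + p ^ Suc f" by (simp add: algebra_simps)
      also have "\<dots> \<le> divsum (n * p ^ Suc f) + 1"
        using t divsum_mult_prime_power_Suc[OF p(1,2), of f] by linarith
      finally show ?case by (auto simp: le_iff_add)
    qed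
    show ?thesis using *[of e] by auto
  qed
  \<comment> \<open>Division by \<open>?q\<close> supplies \<open>j\<close> as long as the quotient
    is at most \<open>divsum n\<close>; otherwise \<open>j = divsum n\<close>, and the upper bound
    on \<open>k\<close> controls the rest.\<close>
  have "\<exists>j\<le>divsum n. j * ?q \<le> k \<and> k - j * ?q \<le> divsum (n * p ^ e)"
  proof (cases "k div ?q \<le> divsum n")
    case True
    have "k - k div ?q * ?q = k mod ?q" by (simp add: minus_div_mult_eq_mod)
    moreover have "k mod ?q < ?q" using q0 by simp
    ultimately show ?thesis using True q_le
      by (intro exI[of _ "k div ?q"]) (auto simp del: power_Suc)
  next
    case False
    have "divsum n * ?q \<le> k div ?q * ?q" using False by (intro mult_le_mono1) simp
    also have "\<dots> \<le> k" by simp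
    finally show ?thesis using k divsum_mult_prime_power_Suc[OF p(1,2), of e]
      by (intro exI[of _ "divsum n"]) (auto simp: algebra_simps)
  qed
  then obtain j where j: "j \<le> divsum n" "j * ?q \<le> k" "k - j * ?q \<le> divsum (n * p ^ e)" by blast
  obtain D where D: "D \<subseteq> {d. d dvd n}" "finite D" "j = \<Sum>D"
    using n j unfolding sum_of_distinct_divisors_def by blast
  obtain E where E: "E \<subseteq> {d. d dvd n * p ^ e}" "finite E" "k - j * ?q = \<Sum>E"
    using IH j unfolding sum_of_distinct_divisors_def by blast
  have disj: "E \<inter> (\<lambda>d. d * ?q) ` D = {}"
  proof (rule ccontr)
    assume "E \<inter> (\<lambda>d. d * ?q) ` D \<noteq> {}"
    then obtain d where "d * ?q dvd n * p ^ e" using E by blast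
    then have "p ^ Suc e dvd n * p ^ e" by (rule dvd_mult_right)
    then have "p * p ^ e dvd n * p ^ e" by simp
    then have "p dvd n" using p by (simp add: prime_gt_0_nat)
    with p show False by simp
  qed
  have "\<Sum>(E \<union> (\<lambda>d. d * ?q) ` D) = \<Sum>E + \<Sum>((\<lambda>d. d * ?q) ` D)"
    using D E disj by (intro sum.union_disjoint) auto
  also have "\<Sum>((\<lambda>d. d * ?q) ` D) = j * ?q"
    using D q0 by (subst sum.reindex) (auto simp: inj_on_def sum_distrib_right simp del: power_Suc)
  finally have "k = \<Sum>(E \<union> (\<lambda>d. d * ?q) ` D)" using E(3) j(2) by linarith
  moreover have "E \<union> (\<lambda>d. d * ?q) ` D \<subseteq> {d. d dvd n * p ^ Suc e}"
    using D E by (auto simp del: power_Suc intro: mult_dvd_mono)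
      (metis (no_types, lifting) dvd_trans dvd_triv_right mem_Collect_eq mult.left_commute power_Suc subsetD)
  ultimately show "sum_of_distinct_divisors (n * p ^ Suc e) k"
    using D E unfolding sum_of_distinct_divisors_def by (metis finite_UnI finite_imageI)
qed

lemma chain_practical_sums:
  "chain_practical n \<Longrightarrow> \<forall>k\<le>divsum n. sum_of_distinct_divisors n k"
proof (induction rule: chain_practical.induct)
  case one
  have "k = 0 \<or> k = 1" if "k \<le> divsum 1" for k using that by auto
  moreover have "sum_of_distinct_divisors 1 0" "sum_of_distinct_divisors 1 1"
    unfolding sum_of_distinct_divisors_def
    by (rule exI[of _ "{}"], simp) (rule exI[of _ "{1}"], simp)
  ultimately show ?case by blast
next
  case (step n p e)
  have "\<forall>k\<le>divsum (n * p ^ e). sum_of_distinct_divisors (n * p ^ e) k"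
  proof (induction e)
    case 0
    then show ?case using step.IH by simp
  next
    case (Suc e)
    then show ?case
      using step chain_practical_pos by (intro sum_of_distinct_divisors_step) auto
  qed
  then show ?case .
qed

text \<open>A representation of \<open>divsum m + 1\<close> by divisors of \<open>n\<close> has all
  terms at most \<open>divsum m + 1\<close>, so \<open>gap\<close> forces them to divide
  \<open>m\<close>; but distinct divisors of \<open>m\<close> total at most
  \<open>divsum m\<close>.\<close>

lemma divisor_sum_reach_eqI:
  assumes "n > 0" "m dvd n" "chain_practical m"
    and gap: "\<And>d. d dvd n \<Longrightarrow> \<not> d dvd m \<Longrightarrow> d > divsum m + 1"
  shows "divisor_sum_reach n = divsum m"
proof (rule antisym)
  have m: "m > 0" using assms(3) chain_practical_pos by blast
  show "divsum m \<le> divisor_sum_reach n"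
    using assms chain_practical_sums[OF assms(3)]
    by (intro divisor_sum_reach(2)) (auto intro: sum_of_distinct_divisors_mono)
  show "divisor_sum_reach n \<le> divsum m"
  proof (rule ccontr)
    assume "\<not> divisor_sum_reach n \<le> divsum m"
    then have "sum_of_distinct_divisors n (divsum m + 1)"
      using divisor_sum_reach(1)[OF \<open>n > 0\<close>] by auto
    then obtain D where D: "D \<subseteq> {d. d dvd n}" "finite D" "divsum m + 1 = \<Sum>D"
      unfolding sum_of_distinct_divisors_def by blast
    have "d dvd m" if "d \<in> D" for d
    proof (rule ccontr)
      assume "\<not> d dvd m"
      then have "d > divsum m + 1" using gap D that by blast
      moreover have "d \<le> \<Sum>D" using D(2) that by (intro member_le_sum) auto
      ultimately show False using D by simp
    qed
    then have "\<Sum>D \<le> divsum m"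
      unfolding divsum_def using m by (intro sum_mono2) auto
    with D show False by simp
  qed
qed

lemma chain_practical_reach: "chain_practical m \<Longrightarrow> divisor_sum_reach m = divsum m"
  by (rule divisor_sum_reach_eqI) (auto intro: chain_practical_pos)

text \<open>Given \<open>n\<close>, the witness is its largest chain-practical divisor
  \<open>m\<close> that is coprime to the cofactor. A prime of \<open>n div m\<close> not exceeding
  \<open>divsum m + 1\<close> could be adjoined to \<open>m\<close>, contradicting
  maximality.\<close>

lemma additive_endpoint_iff: "additive_endpoint v \<longleftrightarrow> (\<exists>m. chain_practical m \<and> v = divsum m)"
proof
  assume "\<exists>m. chain_practical m \<and> v = divsum m"
  then show "additive_endpoint v"
    using chain_practical_reach chain_practical_pos unfolding additive_endpoint_def by metis
next
  assume "additive_endpoint v"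
  then obtain n where n: "n > 0" "v = divisor_sum_reach n"
    unfolding additive_endpoint_def by blast
  define S where "S = {m. chain_practical m \<and> m dvd n \<and> coprime m (n div m)}"
  have "finite S" unfolding S_def by (rule finite_subset[of _ "{d. d dvd n}"]) (use n in auto)
  moreover have "1 \<in> S" unfolding S_def by (auto intro: chain_practical.one[simplified])
  ultimately have mS: "Max S \<in> S" and mMax: "\<And>m. m \<in> S \<Longrightarrow> m \<le> Max S"
    by (auto intro: Max_in)
  define m where "m = Max S"
  have m: "chain_practical m" "m dvd n" "coprime m (n div m)"
    using mS unfolding m_def S_def by auto
  have m0: "m > 0" using m chain_practical_pos by blast
  have large: "p > divsum m + 1" if p: "prime p" "p dvd n div m" for p
  proof (rule ccontr)
    assume small: "\<not> p > divsum m + 1"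
    \<comment> \<open>Adjoining the full power of \<open>p\<close> keeps the enlarged divisor
      coprime to its cofactor.\<close>
    define e where "e = multiplicity p (n div m)"
    have nm0: "n div m \<noteq> 0" using n m by (auto simp: dvd_div_eq_0_iff)
    have e: "e > 0" unfolding e_def using p nm0
      by (simp add: prime_multiplicity_gt_zero_iff)
    have pm: "\<not> p dvd m" using p m by (meson coprime_common_divisor_nat not_prime_1 coprime_def not_prime_unit)
    obtain r where r: "n div m = p ^ e * r" "\<not> p dvd r"
      using multiplicity_decompose'[OF nm0, of p] p unfolding e_def
      by (metis not_prime_unit)
    have nr: "n = m * p ^ e * r" using r m by (metis dvd_mult_div_cancel mult.assoc)
    have "chain_practical (m * p ^ e)"
      using m pm small e p by (intro chain_practical.step) auto
    moreover have "n div (m * p ^ e) = r"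
      using nr m0 p by (simp add: prime_gt_0_nat)
    moreover have "coprime (m * p ^ e) r"
      using m r p by (auto simp: prime_imp_coprime)
    ultimately have "m * p ^ e \<in> S" unfolding S_def using nr by auto
    then have "m * p ^ e \<le> m" using mMax m_def by blast
    moreover have "p ^ e > 1" using p e by (metis one_less_power prime_gt_1_nat)
    ultimately show False using m0 by simp
  qed
  have "divisor_sum_reach n = divsum m"
  proof (rule divisor_sum_reach_eqI)
    fix d assume d: "d dvd n" "\<not> d dvd m"
    \<comment> \<open>A divisor of \<open>n\<close> that does not divide \<open>m\<close> shares a
      prime with \<open>n div m\<close>, and that prime is already too large.\<close>
    have "gcd d (n div m) \<noteq> 1"
    proof
      assume "gcd d (n div m) = 1"
      then have "coprime d (n div m)" by (simp only: coprime_iff_gcd_eq_1)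
      moreover have "d dvd m * (n div m)" using d m by simp
      ultimately have "d dvd m" by (metis coprime_dvd_mult_left_iff)
      with d show False by simp
    qed
    then obtain p where "prime p" "p dvd gcd d (n div m)" using prime_factor_nat by blast
    then have "prime p" "p dvd d" "p dvd n div m" by auto
    moreover have "d > 0" using d n by (auto intro: Nat.gr0I)
    ultimately show "d > divsum m + 1" using large[of p] dvd_imp_le[of p d] by auto
  qed (use n m in auto)
  with n m show "\<exists>m. chain_practical m \<and> v = divsum m" by blast
qed

section \<open>Sums and products over primes\<close>

lemma prod_primes_dvd_iff:
  fixes m :: nat
  assumes "finite D" "\<And>p. p \<in> D \<Longrightarrow> prime p"
  shows "\<Prod>D dvd m \<longleftrightarrow> (\<forall>p\<in>D. p dvd m)"
  using assms
proof (induction D rule: finite_induct)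
  case (insert p D)
  have "coprime p (\<Prod>D)"
    using insert by (intro prod_coprime_right primes_coprime) auto
  then have "p * \<Prod>D dvd m \<longleftrightarrow> p dvd m \<and> \<Prod>D dvd m"
    by (meson divides_mult dvd_mult_left dvd_mult_right)
  with insert show ?case by auto
qed auto

lemma inj_on_prod_primes:
  assumes "\<And>p. p \<in> P \<Longrightarrow> prime (p :: nat)" "finite P"
  shows "inj_on Prod (Pow P)"
proof (rule inj_onI)
  have *: "p \<in> D" if D: "D \<subseteq> P" "p \<in> P" "p dvd \<Prod>D" for p D
  proof -
    have "finite D" using that assms finite_subset by blast
    then obtain q where "q \<in> D" "p dvd q" using D assms prime_dvd_prod_iff[of D p "\<lambda>x. x"] by blast
    then have "p = q" using that assms primes_dvd_imp_eq by blast
    with \<open>q \<in> D\<close> show ?thesis by simp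
  qed
  fix D E assume DE: "D \<in> Pow P" "E \<in> Pow P" "\<Prod>D = \<Prod>E"
  have fin: "finite D" "finite E" using DE assms finite_subset by blast+
  show "D = E"
  proof (intro equalityI subsetI)
    fix p assume "p \<in> D"
    then have "p dvd \<Prod>E" using fin DE by (metis dvd_prodI)
    with \<open>p \<in> D\<close> show "p \<in> E" using * DE by blast
  next
    fix p assume "p \<in> E"
    then have "p dvd \<Prod>D" using fin DE by (metis dvd_prodI)
    with \<open>p \<in> E\<close> show "p \<in> D" using * DE by blast
  qed
qed

section \<open>Mertens-type upper bound for the sum over primes\<close>

lemma prod_one_plus:
  fixes f :: "'a \<Rightarrow> real"
  assumes "finite P"
  shows "(\<Prod>p\<in>P. 1 + f p) = (\<Sum>D\<in>Pow P. \<Prod>p\<in>D. f p)"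
  using prod_add[OF assms, of f "\<lambda>_. 1"] by (simp add: add.commute[of 1])

lemma sum_powr_le:
  assumes "s > (0 :: real)"
  shows "(\<Sum>n=1..M. real n powr - (1 + s)) \<le> 1 + 1 / s"
proof -
  \<comment> \<open>The sharper bound, 1 plus the integral of \<open>t powr - (1 + s)\<close> from 1
    to \<open>Suc M\<close>, makes the induction close.\<close>
  have "(\<Sum>n=1..Suc M. real n powr - (1 + s)) \<le> 1 + (1 - real (Suc M) powr - s) / s" for M
  proof (induction M)
    case (Suc M)
    define a where "a = real (Suc M)"
    have a: "a > 0" by (simp add: a_def)
    have "s / (a + 1) \<le> s * (ln (a + 1) - ln a)"
    proof -
      have "ln (a / (a + 1)) \<le> a / (a + 1) - 1" using a by (intro ln_le_minus_one) auto
      then have "1 / (a + 1) \<le> ln (a + 1) - ln a" using a by (simp add: ln_div field_simps)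
      then show ?thesis using assms mult_left_mono[of "1 / (a + 1)" _ s] by simp
    qed
    also have "\<dots> \<le> exp (s * (ln (a + 1) - ln a)) - 1"
      using exp_ge_add_one_self[of "s * (ln (a + 1) - ln a)"] by linarith
    finally have "(a + 1) powr - s * (s / (a + 1)) \<le> (a + 1) powr - s * (exp (s * (ln (a + 1) - ln a)) - 1)"
      by (intro mult_left_mono) auto
    also have "\<dots> = a powr - s - (a + 1) powr - s"
      using a by (simp add: powr_def algebra_simps flip: exp_add)
    also have "(a + 1) powr - s * (s / (a + 1)) = s * (a + 1) powr - (1 + s)"
      using a by (simp add: powr_diff powr_minus divide_simps powr_add)
    finally have "(a + 1) powr - (1 + s) \<le> (a powr - s - (a + 1) powr - s) / s"
      using assms by (simp add: field_simps)
    moreover have "(\<Sum>n=1..Suc (Suc M). real n powr - (1 + s))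
        = (\<Sum>n=1..Suc M. real n powr - (1 + s)) + (a + 1) powr - (1 + s)"
      by (simp add: a_def add_ac)
    moreover have "real (Suc (Suc M)) = a + 1" by (simp add: a_def)
    ultimately show ?case
      using Suc unfolding a_def[symmetric] by (simp only: diff_divide_distrib)
  qed auto
  moreover have "1 + (1 - real (Suc M) powr - s) / s \<le> 1 + 1 / s" for M
    using assms by (simp add: divide_right_mono)
  ultimately have "(\<Sum>n=1..Suc M. real n powr - (1 + s)) \<le> 1 + 1 / s" for M
    by (meson order_trans)
  then show ?thesis using assms by (cases M) auto
qed

text \<open>On \<open>p <= z\<close> the weight \<open>f p\<close>, with exponent shifted by
  \<open>1 / ln z\<close>, differs from \<open>1 / p\<close> by a factor of at most
  \<open>exp 1 <= 3\<close>. The product of \<open>1 + f p\<close> is a sum over squarefree numbers,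
  hence at most \<open>1 + ln z\<close>. The constant is 6 = 3 * 2, the 2 coming from
  \<open>exp (u / 2) <= 1 + u\<close> for \<open>u\<close> between 0 and 1.\<close>

lemma sum_inverse_primes_le:
  fixes z :: real
  assumes "z \<ge> 3"
  shows "(\<Sum>p | prime p \<and> real p \<le> z. 1 / real p) \<le> 6 * ln (1 + ln z)"
proof -
  define P where "P = {p. prime p \<and> real p \<le> z}"
  have fin: "finite P"
  proof (rule finite_subset)
    show "P \<subseteq> {..nat \<lfloor>z\<rfloor>}" unfolding P_def using assms by (auto simp: le_nat_floor)
  qed simp
  have pr: "prime p" if "p \<in> P" for p using that by (simp add: P_def)
  define \<delta> where "\<delta> = 1 / ln z"
  have lz: "ln z > 1"
    using assms ln3_gt_1 ln_le_cancel_iff[of 3 z] by linarith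
  then have d: "\<delta> > 0" by (simp add: \<delta>_def)
  define f where "f = (\<lambda>p. real p powr - (1 + \<delta>))"
  have f: "0 \<le> f p" "f p \<le> 1" if "p \<in> P" for p
  proof -
    have "real p powr - (1 + \<delta>) \<le> real p powr 0"
      using pr[OF that] d prime_ge_1_nat[of p] by (intro powr_mono) auto
    then show "0 \<le> f p" "f p \<le> 1"
      using prime_gt_0_nat[OF pr[OF that]] by (auto simp: f_def)
  qed
  have "exp ((\<Sum>p\<in>P. f p) / 2) = (\<Prod>p\<in>P. exp (f p / 2))"
    using fin by (simp add: exp_sum sum_divide_distrib)
  also have "\<dots> \<le> (\<Prod>p\<in>P. 1 + f p)"
  proof (rule prod_mono)
    fix p assume "p \<in> P"
    have "exp (f p / 2) \<le> 1 + f p / 2 + (f p / 2)\<^sup>2"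
      using f[OF \<open>p \<in> P\<close>] by (intro exp_bound) auto
    also have "(f p / 2)\<^sup>2 \<le> f p / 2"
      using f[OF \<open>p \<in> P\<close>] power_decreasing[of 1 2 "f p / 2"] by simp
    finally show "0 \<le> exp (f p / 2) \<and> exp (f p / 2) \<le> 1 + f p" by simp
  qed
  also have "\<dots> = (\<Sum>D\<in>Pow P. \<Prod>p\<in>D. f p)"
    by (rule prod_one_plus[OF fin])
  also have "\<dots> = (\<Sum>D\<in>Pow P. f (\<Prod>D))"
  proof (rule sum.cong[OF refl])
    fix D assume "D \<in> Pow P"
    then have "finite D" using fin finite_subset by blast
    then show "(\<Prod>p\<in>D. f p) = f (\<Prod>D)"
      unfolding f_def by (induction D rule: finite_induct) (auto simp: powr_mult)
  qed
  also have "\<dots> = (\<Sum>n\<in>Prod ` Pow P. f n)"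
    using inj_on_prod_primes[OF pr fin] by (simp add: sum.reindex)
  also have "\<dots> \<le> (\<Sum>n=1..\<Prod>P. f n)"
  proof (rule sum_mono2)
    show "Prod ` Pow P \<subseteq> {1..\<Prod>P}"
    proof safe
      fix D assume D: "D \<subseteq> P"
      have P0: "\<Prod>P > 0" using pr by (auto intro!: prod_pos simp: prime_gt_0_nat)
      have "\<Prod>D > 0" using pr D by (auto intro!: prod_pos simp: prime_gt_0_nat)
      moreover have "\<Prod>D \<le> \<Prod>P" using fin D P0 by (intro dvd_imp_le prod_dvd_prod_subset)
      ultimately show "\<Prod>D \<in> {1..\<Prod>P}" by simp
    qed
  qed (auto simp: f_def)
  also have "\<dots> \<le> 1 + 1 / \<delta>"
    unfolding f_def by (rule sum_powr_le[OF d])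
  also have "\<dots> = 1 + ln z" by (simp add: \<delta>_def)
  finally have "(\<Sum>p\<in>P. f p) / 2 \<le> ln (1 + ln z)"
    using lz by (subst ln_ge_iff) auto
  moreover have "(\<Sum>p\<in>P. 1 / real p) \<le> (\<Sum>p\<in>P. 3 * f p)"
  proof (rule sum_mono)
    fix p assume p: "p \<in> P"
    then have p0: "real p \<ge> 1" using pr[OF p] prime_gt_0_nat[of p] by (simp add: Suc_leI)
    have "ln (real p) \<le> ln z" using p p0 assms by (simp add: P_def)
    then have "real p powr \<delta> \<le> exp 1"
      using p0 lz by (simp add: powr_def \<delta>_def)
    also have "\<dots> \<le> 3" by (rule exp_le)
    finally show "1 / real p \<le> 3 * f p"
      using p0 by (simp add: f_def powr_minus powr_add field_simps powr_diff)
  qed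
  ultimately show ?thesis unfolding P_def[symmetric] by (simp add: sum_distrib_left[symmetric])
qed

section \<open>Counting multiples and averaging multiplicative weights\<close>

lemma card_multiples_le:
  assumes "d > 0"
  shows "real (card {m\<in>{1..N}. d dvd m}) \<le> real N / real d"
proof -
  have "{m\<in>{1..N}. d dvd m} \<subseteq> (\<lambda>k. d * k) ` {1..N div d}"
  proof
    fix m assume m: "m \<in> {m\<in>{1..N}. d dvd m}"
    then obtain k where k: "m = d * k" by auto
    with m have "k \<ge> 1" "k \<le> N div d" using assms
      by (auto simp: less_eq_div_iff_mult_less_eq mult.commute Suc_le_eq)
    with k show "m \<in> (\<lambda>k. d * k) ` {1..N div d}" by auto
  qed
  then have "card {m\<in>{1..N}. d dvd m} \<le> card ((\<lambda>k. d * k) ` {1..N div d})"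
    by (intro card_mono) auto
  also have "\<dots> \<le> N div d" using card_image_le[of "{1..N div d}"] by simp
  finally have "real (card {m\<in>{1..N}. d dvd m}) \<le> real (N div d)" by simp
  also have "\<dots> \<le> real N / real d" by (rule of_nat_div_le_of_nat)
  finally show ?thesis .
qed

text \<open>Union bound over \<open>d\<close>; the sum of \<open>1 / d ^ 2\<close> beyond
  \<open>D\<close> telescopes against \<open>1 / D\<close>.\<close>

lemma card_square_divisor_le:
  assumes "D > 0"
  shows "real (card {m\<in>{1..N}. \<exists>d>D. d ^ 2 dvd m}) \<le> real N / real D"
proof -
  have tele: "(\<Sum>d\<in>{D<..D + M}. 1 / real d ^ 2) \<le> 1 / real D - 1 / real (D + M)" for M
  proof (induction M)
    case (Suc M)
    define a where "a = real (D + M)"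
    have a: "a > 0" using assms by (simp add: a_def)
    have "1 / (a + 1) ^ 2 \<le> 1 / a - 1 / (a + 1)"
      using a by (simp add: divide_simps power2_eq_square) (simp add: algebra_simps)?
    moreover have "{D<..D + Suc M} = insert (D + Suc M) {D<..D + M}" by auto
    moreover have "real (D + Suc M) = a + 1" by (simp add: a_def)
    ultimately show ?case using Suc unfolding a_def[symmetric] by (simp add: add.commute)
  qed simp
  have "{m\<in>{1..N}. \<exists>d>D. d ^ 2 dvd m} \<subseteq> (\<Union>d\<in>{D<..D + N}. {m\<in>{1..N}. d ^ 2 dvd m})"
  proof safe
    fix m d assume m: "m \<in> {1..N}" "d > D" "d ^ 2 dvd m"
    have "d \<le> d ^ 2" by (simp add: power2_eq_square)
    also have "\<dots> \<le> m" using m by (intro dvd_imp_le) auto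
    finally show "m \<in> (\<Union>d\<in>{D<..D + N}. {m\<in>{1..N}. d ^ 2 dvd m})" using m by auto
  qed
  then have "card {m\<in>{1..N}. \<exists>d>D. d ^ 2 dvd m} \<le> card (\<Union>d\<in>{D<..D + N}. {m\<in>{1..N}. d ^ 2 dvd m})"
    by (intro card_mono) auto
  also have "\<dots> \<le> (\<Sum>d\<in>{D<..D + N}. card {m\<in>{1..N}. d ^ 2 dvd m})"
    by (rule card_UN_le) simp
  finally have "real (card {m\<in>{1..N}. \<exists>d>D. d ^ 2 dvd m}) \<le> (\<Sum>d\<in>{D<..D + N}. real (card {m\<in>{1..N}. d ^ 2 dvd m}))"
    by (simp flip: of_nat_sum)
  also have "\<dots> \<le> (\<Sum>d\<in>{D<..D + N}. real N * (1 / real d ^ 2))"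
  proof (rule sum_mono)
    fix d assume "d \<in> {D<..D + N}"
    then show "real (card {m\<in>{1..N}. d ^ 2 dvd m}) \<le> real N * (1 / real d ^ 2)"
      using card_multiples_le[of "d ^ 2" N] by simp
  qed
  also have "\<dots> = real N * (\<Sum>d\<in>{D<..D + N}. 1 / real d ^ 2)" by (simp add: sum_distrib_left)
  also have "\<dots> \<le> real N * (1 / real D)"
    using tele[of N] by (intro mult_left_mono) (auto intro: order_trans)
  finally show ?thesis by simp
qed

text \<open>Expanding the product over sets of primes turns the average into counts of multiples of
  squarefree numbers; \<open>1 + u <= exp u\<close> then bounds the resulting Euler product.\<close>

lemma sum_prod_prime_factors_le:
  fixes g :: "nat \<Rightarrow> real"
  assumes g: "\<And>p. g p \<ge> 0"
  shows "(\<Sum>m=1..N. \<Prod>p\<in>prime_factors m. 1 + g p)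
           \<le> real N * exp (\<Sum>p | prime p \<and> p \<le> N. g p / real p)"
proof -
  define P where "P = {p. prime p \<and> p \<le> N}"
  have fin: "finite P" unfolding P_def by auto
  have pr: "prime p" if "p \<in> P" for p using that by (simp add: P_def)
  have "(\<Sum>m=1..N. \<Prod>p\<in>prime_factors m. 1 + g p)
      = (\<Sum>m=1..N. \<Sum>D\<in>Pow P. if \<Prod>D dvd m then \<Prod>p\<in>D. g p else 0)"
  proof (rule sum.cong[OF refl])
    fix m assume m: "m \<in> {1..N}"
    have sub: "prime_factors m \<subseteq> P"
      using m by (auto simp: P_def in_prime_factors_iff dest!: dvd_imp_le)
    have "(\<Prod>p\<in>prime_factors m. 1 + g p) = (\<Sum>D\<in>Pow (prime_factors m). \<Prod>p\<in>D. g p)"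
      by (rule prod_one_plus) simp
    also have "Pow (prime_factors m) = {D\<in>Pow P. \<Prod>D dvd m}"
    proof -
      have "D \<subseteq> prime_factors m \<longleftrightarrow> \<Prod>D dvd m" if "D \<subseteq> P" for D
      proof -
        have "finite D" using that fin finite_subset by blast
        then have "\<Prod>D dvd m \<longleftrightarrow> (\<forall>p\<in>D. p dvd m)"
          using that pr by (intro prod_primes_dvd_iff) auto
        then show ?thesis using that pr m by (auto simp: in_prime_factors_iff)
      qed
      then show ?thesis using sub by blast
    qed
    also have "(\<Sum>D\<in>\<dots>. \<Prod>p\<in>D. g p) = (\<Sum>D\<in>Pow P. if \<Prod>D dvd m then \<Prod>p\<in>D. g p else 0)"
      using fin by (intro sum.inter_filter) simp
    finally show "(\<Prod>p\<in>prime_factors m. 1 + g p) = \<dots>" .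
  qed
  also have "\<dots> = (\<Sum>D\<in>Pow P. \<Sum>m=1..N. if \<Prod>D dvd m then \<Prod>p\<in>D. g p else 0)"
    by (rule sum.swap)
  also have "\<dots> = (\<Sum>D\<in>Pow P. real (card {m\<in>{1..N}. \<Prod>D dvd m}) * (\<Prod>p\<in>D. g p))"
    by (simp add: sum.inter_filter[symmetric])
  also have "\<dots> \<le> (\<Sum>D\<in>Pow P. real N / real (\<Prod>D) * (\<Prod>p\<in>D. g p))"
  proof (rule sum_mono)
    fix D assume D: "D \<in> Pow P"
    then have "\<Prod>D > 0" using pr by (auto intro!: prod_pos simp: prime_gt_0_nat)
    then show "real (card {m\<in>{1..N}. \<Prod>D dvd m}) * (\<Prod>p\<in>D. g p) \<le> real N / real (\<Prod>D) * (\<Prod>p\<in>D. g p)"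
      using g by (intro mult_right_mono card_multiples_le prod_nonneg) auto
  qed
  also have "\<dots> = real N * (\<Sum>D\<in>Pow P. \<Prod>p\<in>D. g p / real p)"
    by (simp add: sum_distrib_left prod_dividef)
  also have "\<dots> = real N * (\<Prod>p\<in>P. 1 + g p / real p)"
    by (simp add: prod_one_plus[OF fin])
  also have "\<dots> \<le> real N * (\<Prod>p\<in>P. exp (g p / real p))"
    using g by (intro mult_left_mono prod_mono) (auto intro: add_nonneg_nonneg)
  also have "\<dots> = real N * exp (\<Sum>p\<in>P. g p / real p)"
    using fin by (simp add: exp_sum)
  finally show ?thesis unfolding P_def .
qed

text \<open>A finite Euler product for the completely multiplicative weight
  \<open>c ^ Omega(v) / v\<close>; \<open>c < 2\<close> keeps the factor at the prime 2 positive.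
  For a new prime \<open>q\<close> the inner induction on \<open>N\<close> replaces the geometric
  series: the terms with \<open>q dvd v\<close> amount to \<open>c / q\<close> times the same sum up
  to \<open>N div q\<close>.\<close>

lemma sum_smooth_Omega_le:
  fixes P :: "nat set" and c :: real
  assumes "finite P" "\<And>p. p \<in> P \<Longrightarrow> prime p" and c: "0 \<le> c" "c < 2"
  shows "(\<Sum>v | v \<in> {1..N} \<and> prime_factors v \<subseteq> P. c ^ size (prime_factorization v) / real v)
      \<le> (\<Prod>p\<in>P. 1 / (1 - c / real p))"
  using assms(1,2)
proof (induction P arbitrary: N rule: finite_induct)
  case empty
  have "(\<Sum>v | v \<in> {1..N} \<and> prime_factors v \<subseteq> {}. c ^ size (prime_factorization v) / real v)
     = (\<Sum>v | v \<in> {1..N} \<and> v = 1. 1)"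
    by (rule sum.cong) (auto simp: prime_factorization_empty_iff)
  also have "\<dots> \<le> 1"
    by (cases "N = 0") (auto simp: Collect_conv_if conj_commute)
  finally show ?case by simp
next
  case (insert q P)
  have q: "prime q" using insert by auto
  then have q2: "real q \<ge> 2" using prime_ge_2_nat[of q] by simp
  define C where "C = (\<Prod>p\<in>P. 1 / (1 - c / real p))"
  define C' where "C' = C / (1 - c / real q)"
  have C': "(\<Prod>p\<in>insert q P. 1 / (1 - c / real p)) = C'"
    using insert by (simp add: C_def C'_def)
  have pos: "1 - c / real q > 0" using q2 c by (simp add: field_simps)
  then have "C' * (1 - c / real q) = C"
    unfolding C'_def by (metis less_irrefl nonzero_divide_eq_eq)
  \<comment> \<open>\<open>C'\<close> is the fixed point of the recursion: \<open>C\<close> from the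
    \<open>v\<close> prime to \<open>q\<close>, and \<open>c / q\<close> times the bound itself from
    the others.\<close>
  then have CC': "C' = C + c / real q * C'"
    by (simp add: algebra_simps)
  have "C \<ge> 0"
    unfolding C_def
  proof (intro prod_nonneg)
    fix p assume "p \<in> P"
    then have "real p \<ge> 2" using insert.prems prime_ge_2_nat[of p] by simp
    then show "0 \<le> 1 / (1 - c / real p)" using c by (simp add: field_simps)
  qed
  then have C'0: "C' \<ge> 0" using pos by (simp add: C'_def)
  let ?w = "\<lambda>v. c ^ size (prime_factorization v) / real v"
  define G :: "nat \<Rightarrow> nat set \<Rightarrow> real"
    where "G = (\<lambda>N Q. \<Sum>v | v \<in> {1..N} \<and> prime_factors v \<subseteq> Q. ?w v)"
  have "G N (insert q P) \<le> C'" for N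
  proof (induction N rule: less_induct)
    case (less N)
    show ?case
    proof (cases "N = 0")
      case True
      then show ?thesis using C'0 by (simp add: G_def)
    next
      case False
      let ?A = "{v. v \<in> {1..N} \<and> prime_factors v \<subseteq> insert q P}"
      let ?B = "{v. v \<in> {1..N} \<and> prime_factors v \<subseteq> P}"
      let ?C = "{v. v \<in> {1..N div q} \<and> prime_factors v \<subseteq> insert q P}"
      have sub: "?A \<subseteq> ?B \<union> (\<lambda>v. q * v) ` ?C"
      proof
        fix v assume v: "v \<in> ?A"
        show "v \<in> ?B \<union> (\<lambda>v. q * v) ` ?C"
        proof (cases "q dvd v")
          case True
          then obtain u where u: "v = q * u" by auto
          with v have "u \<noteq> 0" "u \<le> N div q" using q
            by (auto simp: less_eq_div_iff_mult_less_eq prime_gt_0_nat mult.commute)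
          moreover have "prime_factors u \<subseteq> prime_factors v"
            using u v by (intro dvd_prime_factors) auto
          ultimately show ?thesis using u v by auto
        next
          case False
          then have "q \<notin> prime_factors v" by (auto dest: in_prime_factors_imp_dvd)
          then show ?thesis using v by auto
        qed
      qed
      have "G N (insert q P) \<le> sum ?w (?B \<union> (\<lambda>v. q * v) ` ?C)"
        unfolding G_def using sub c by (intro sum_mono2) auto
      also have "\<dots> \<le> sum ?w ?B + sum ?w ((\<lambda>v. q * v) ` ?C)"
        using c by (subst sum_Un) (auto intro!: sum_nonneg)
      also have "sum ?w ((\<lambda>v. q * v) ` ?C) = (\<Sum>v\<in>?C. ?w (q * v))"
        using q by (subst sum.reindex) (auto simp: inj_on_def prime_gt_0_nat)
      also have "\<dots> = (\<Sum>v\<in>?C. c / real q * ?w v)"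
        using q by (intro sum.cong) (auto simp: prime_factorization_mult prime_factorization_prime)
      also have "\<dots> = c / real q * G (N div q) (insert q P)"
        by (simp add: G_def sum_distrib_left)
      also have "\<dots> \<le> c / real q * C'"
        using False prime_gt_1_nat[OF q] c by (intro mult_left_mono less) auto
      also have "sum ?w ?B \<le> C"
        unfolding C_def using insert.prems by (intro insert.IH) auto
      finally show ?thesis using CC' by simp
    qed
  qed
  then show ?case unfolding G_def C' .
qed

lemma sum_Omega_div_le:
  fixes c :: real
  assumes "0 \<le> c" "c < 2"
  shows "(\<Sum>v=1..N. c ^ size (prime_factorization v) / real v)
      \<le> (\<Prod>p | prime p \<and> p \<le> N. 1 / (1 - c / real p))"
proof -
  have eq: "{v. v \<in> {1..N} \<and> prime_factors v \<subseteq> {p. prime p \<and> p \<le> N}} = {1..N}"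
    by (auto simp: in_prime_factors_iff dest!: dvd_imp_le)
  have "(\<Sum>v | v \<in> {1..N} \<and> prime_factors v \<subseteq> {p. prime p \<and> p \<le> N}. c ^ size (prime_factorization v) / real v)
      \<le> (\<Prod>p | prime p \<and> p \<le> N. 1 / (1 - c / real p))"
    using assms by (intro sum_smooth_Omega_le) auto
  then show ?thesis unfolding eq .
qed

text \<open>The weight \<open>1 / v\<close> is introduced at the price of a factor
  \<open>N / v >= 1\<close>. The exponent is 36 = 6 * 6: the Euler factor is at most
  \<open>1 + 6 / p\<close>, with equality at \<open>p = 2\<close>, and
  \<open>sum_inverse_primes_le\<close> contributes the other 6.\<close>

lemma sum_Omega_le:
  assumes "N \<ge> 3"
  shows "(\<Sum>v=1..N. (3/2) ^ size (prime_factorization v)) \<le> real N * (1 + ln (real N)) powr 36"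
proof -
  define P where "P = {p. prime p \<and> real p \<le> real N}"
  have fin: "finite P" unfolding P_def by simp
  have pr: "prime p" if "p \<in> P" for p using that by (simp add: P_def)
  have "(\<Sum>v=1..N. (3/2) ^ size (prime_factorization v))
      \<le> (\<Sum>v=1..N. real N * ((3/2) ^ size (prime_factorization v) / real v))"
    by (intro sum_mono) (auto simp: field_simps)
  also have "\<dots> = real N * (\<Sum>v=1..N. (3/2) ^ size (prime_factorization v) / real v)"
    by (simp add: sum_distrib_left)
  also have "(\<Sum>v=1..N. (3/2) ^ size (prime_factorization v) / real v) \<le> (\<Prod>p\<in>P. 1 / (1 - (3/2) / real p))"
    unfolding P_def using sum_Omega_div_le[of "3/2" N] by simp
  also have "(\<Prod>p\<in>P. 1 / (1 - (3/2) / real p)) \<le> (\<Prod>p\<in>P. exp (6 * (1 / real p)))"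
  proof (rule prod_mono)
    fix p assume "p \<in> P"
    then have p: "real p \<ge> 2" using pr prime_ge_2_nat[of p] by simp
    have "1 / (1 - (3/2) / real p) \<le> 1 + 6 * (1 / real p)"
      using p by (simp add: divide_simps) (simp add: algebra_simps)?
    also have "\<dots> \<le> exp (6 * (1 / real p))" by (rule exp_ge_add_one_self)
    finally show "0 \<le> 1 / (1 - (3/2) / real p) \<and> 1 / (1 - (3/2) / real p) \<le> exp (6 * (1 / real p))"
      using p by (simp add: divide_simps)
  qed
  also have "\<dots> = exp (6 * (\<Sum>p\<in>P. 1 / real p))"
    using fin by (simp add: exp_sum sum_distrib_left)
  also have "\<dots> \<le> exp (6 * (6 * ln (1 + ln (real N))))"
    unfolding P_def using assms by (intro exp_mono mult_left_mono sum_inverse_primes_le) auto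
  also have "\<dots> = (1 + ln (real N)) powr 36"
  proof -
    have "ln (real N) \<ge> 0" using assms by (intro ln_ge_zero) simp
    then show ?thesis by (simp add: powr_def)
  qed
  finally show ?thesis by (simp add: mult_left_mono)
qed

text \<open>The case \<open>c = 1\<close> of \<open>sum_Omega_div_le\<close> bounds the harmonic sum
  by an Euler product, so the product of \<open>1 - 1 / p\<close> is at most
  \<open>1 / ln z\<close>. The inequality \<open>(1 - 3/2 * u)^2 <= (1 - u)^3\<close> for
  \<open>u <= 1/2\<close> transfers this, factor by factor, to the exponent 3/2.\<close>

lemma prod_one_minus_inverse_primes_le:
  fixes z :: real
  assumes "z \<ge> 3"
  shows "(\<Prod>p | prime p \<and> real p \<le> z. 1 - 3 / (2 * real p)) \<le> ln z powr - (3/2)"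
proof -
  define N where "N = nat \<lfloor>z\<rfloor>"
  define P where "P = {p. prime p \<and> p \<le> N}"
  have P: "{p. prime p \<and> real p \<le> z} = P"
    unfolding P_def N_def using assms by (auto simp: le_nat_floor) linarith
  have fin: "finite P" by (simp add: P_def)
  have lz: "ln z > 0" using assms by simp
  have p2: "real p \<ge> 2" if "p \<in> P" for p
    using that prime_ge_2_nat[of p] by (simp add: P_def)
  define A where "A = (\<Prod>p\<in>P. 1 - 1 / real p)"
  have A0: "A > 0" unfolding A_def using p2 by (intro prod_pos) (fastforce simp: field_simps)
  have "z < real N + 1" unfolding N_def using assms by linarith
  then have "ln z \<le> ln (real N + 1)" using assms by simp
  also have "\<dots> \<le> harm N" by (rule ln_le_harm)
  also have "\<dots> \<le> (\<Prod>p\<in>P. 1 / (1 - 1 / real p))"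
    using sum_Omega_div_le[of 1 N] by (simp add: harm_def P_def inverse_eq_divide)
  also have "\<dots> = 1 / A" by (simp add: A_def prod_dividef)
  finally have A: "A \<le> 1 / ln z" using lz A0 by (simp add: field_simps)
  define B where "B = (\<Prod>p\<in>P. 1 - 3 / (2 * real p))"
  have B0: "B \<ge> 0" unfolding B_def using p2 by (intro prod_nonneg) (fastforce simp: field_simps)
  have "B ^ 2 \<le> A ^ 3"
    unfolding A_def B_def prod_power_distrib
  proof (rule prod_mono)
    fix p assume "p \<in> P"
    define u where "u = 1 / real p"
    have u: "0 < u" "u \<le> 1/2" using p2[OF \<open>p \<in> P\<close>] by (auto simp: u_def field_simps)
    have "(1 - u) ^ 3 - (1 - 3/2 * u) ^ 2 = u ^ 2 * (3/4 - u)"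
      by (simp add: power2_eq_square power3_eq_cube algebra_simps)
    also have "\<dots> \<ge> 0" using u by simp
    finally show "0 \<le> (1 - 3 / (2 * real p)) ^ 2 \<and> (1 - 3 / (2 * real p)) ^ 2 \<le> (1 - 1 / real p) ^ 3"
      by (simp add: u_def)
  qed
  also have "\<dots> \<le> (1 / ln z) ^ 3" using A A0 by (intro power_mono) auto
  also have "\<dots> = (ln z powr - (3/2)) ^ 2"
    using lz by (simp add: powr_power powr_minus powr_numeral power_one_over inverse_eq_divide)
  finally show ?thesis unfolding P B_def[symmetric]
    by (rule power2_le_imp_le) simp
qed

section \<open>Brun's pure sieve\<close>

text \<open>Inclusion-exclusion for the product of \<open>1 - h q\<close>, truncated at subsets of
  at most \<open>k\<close> elements; the recursion decides whether \<open>q\<close> belongs to the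
  subset.\<close>

fun truncated_prod :: "('a \<Rightarrow> real) \<Rightarrow> 'a list \<Rightarrow> nat \<Rightarrow> real" where
  "truncated_prod h [] k = 1"
| "truncated_prod h (q # qs) 0 = 1"
| "truncated_prod h (q # qs) (Suc k) = truncated_prod h qs (Suc k) - h q * truncated_prod h qs k"

lemma prod_list_one_minus_bounds:
  fixes h :: "'a \<Rightarrow> real"
  assumes "\<forall>q\<in>set qs. 0 \<le> h q \<and> h q \<le> 1"
  shows "0 \<le> (\<Prod>q\<leftarrow>qs. 1 - h q) \<and> (\<Prod>q\<leftarrow>qs. 1 - h q) \<le> 1"
  using assms by (induction qs) (auto intro!: mult_le_one)

text \<open>The two truncations in the recursive equation have opposite parity, so subtracting
  \<open>h q\<close> times the second preserves the direction of the first.\<close>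

lemma bonferroni:
  assumes "\<forall>q\<in>set qs. 0 \<le> h q \<and> h q \<le> 1"
  shows "(even k \<longrightarrow> (\<Prod>q\<leftarrow>qs. 1 - h q) \<le> truncated_prod h qs k) \<and>
         (odd k \<longrightarrow> truncated_prod h qs k \<le> (\<Prod>q\<leftarrow>qs. 1 - h q))"
  using assms
proof (induction h qs k rule: truncated_prod.induct)
  case (2 h q qs)
  then show ?case using prod_list_one_minus_bounds[of "q # qs" h] by simp
next
  case (3 h q qs k)
  have h: "0 \<le> h q" using 3 by auto
  let ?p = "\<Prod>q\<leftarrow>qs. 1 - h q"
  have e: "(\<Prod>q\<leftarrow>q # qs. 1 - h q) = ?p - h q * ?p" by (simp add: algebra_simps)
  show ?case
  proof (cases "even k")
    case True
    then have "?p \<le> truncated_prod h qs k" "truncated_prod h qs (Suc k) \<le> ?p" using 3 by auto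
    moreover from this have "h q * ?p \<le> h q * truncated_prod h qs k" using h by (intro mult_left_mono)
    ultimately show ?thesis using True unfolding e by simp
  next
    case False
    then have "truncated_prod h qs k \<le> ?p" "?p \<le> truncated_prod h qs (Suc k)" using 3 by auto
    moreover from this have "h q * truncated_prod h qs k \<le> h q * ?p" using h by (intro mult_left_mono)
    ultimately show ?thesis using False unfolding e by simp
  qed
qed auto

text \<open>The first two terms of the binomial expansion. They let a power bound absorb one more
  list element, both for the truncation error and for the rounding error of the sieve.\<close>

lemma power_Suc_add_ge:
  fixes x h :: real
  assumes "x \<ge> 0" "h \<ge> 0"
  shows "x ^ Suc k + real (Suc k) * h * x ^ k \<le> (x + h) ^ Suc k"
proof (induction k)
  case (Suc k)
  have "x ^ Suc (Suc k) + real (Suc (Suc k)) * h * x ^ Suc k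
      \<le> (x ^ Suc k + real (Suc k) * h * x ^ k) * (x + h)"
    using assms by (simp add: algebra_simps)
  also have "\<dots> \<le> (x + h) ^ Suc k * (x + h)"
    using assms Suc by (intro mult_right_mono) auto
  finally show ?case by (simp add: mult.commute)
qed simp

text \<open>The usual bound for the elementary symmetric function of degree \<open>Suc k\<close>,
  the first omitted term, proved by induction without introducing that function.\<close>

lemma truncated_prod_approx:
  assumes "\<forall>q\<in>set qs. 0 \<le> h q \<and> h q \<le> 1"
  shows "\<bar>truncated_prod h qs k - (\<Prod>q\<leftarrow>qs. 1 - h q)\<bar> \<le> (\<Sum>q\<leftarrow>qs. h q) ^ Suc k / fact (Suc k)"
  using assms
proof (induction h qs k rule: truncated_prod.induct)
  case (2 h q qs)
  have "1 - (\<Prod>q\<leftarrow>xs. 1 - h q) \<le> (\<Sum>q\<leftarrow>xs. h q)" if "\<forall>q\<in>set xs. 0 \<le> h q \<and> h q \<le> 1" for xs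
    using that
  proof (induction xs)
    case (Cons a xs)
    let ?p = "\<Prod>q\<leftarrow>xs. 1 - h q"
    have "h a * ?p \<le> h a * 1"
      using Cons.prems prod_list_one_minus_bounds[of xs h] by (intro mult_left_mono) auto
    then show ?case using Cons by (simp add: algebra_simps)
  qed simp
  from this[OF 2] show ?case using prod_list_one_minus_bounds[OF 2] by simp
next
  case (3 h q qs k)
  have h: "0 \<le> h q" using 3 by auto
  let ?p = "\<Prod>q\<leftarrow>qs. 1 - h q" and ?s = "\<Sum>q\<leftarrow>qs. h q"
  let ?a = "truncated_prod h qs (Suc k) - ?p" and ?b = "truncated_prod h qs k - ?p"
  have s: "?s \<ge> 0" using 3 by (intro sum_list_nonneg) auto
  have "truncated_prod h (q # qs) (Suc k) - (\<Prod>q\<leftarrow>q # qs. 1 - h q) = ?a - h q * ?b"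
    by (simp add: algebra_simps)
  also have "\<bar>\<dots>\<bar> \<le> \<bar>?a\<bar> + h q * \<bar>?b\<bar>"
    using h abs_triangle_ineq4[of ?a "h q * ?b"] by (simp add: abs_mult)
  also have "\<dots> \<le> ?s ^ Suc (Suc k) / fact (Suc (Suc k)) + h q * (?s ^ Suc k / fact (Suc k))"
    using 3 h by (intro add_mono mult_left_mono) auto
  also have "\<dots> = (?s ^ Suc (Suc k) + real (Suc (Suc k)) * h q * ?s ^ Suc k) / fact (Suc (Suc k))"
    unfolding fact_Suc[of "Suc k"] add_divide_distrib by (simp del: fact_Suc)
  also have "\<dots> \<le> (?s + h q) ^ Suc (Suc k) / fact (Suc (Suc k))"
    using s h by (intro divide_right_mono power_Suc_add_ge) auto
  finally show ?case by (simp add: add.commute[of "h q"] del: fact_Suc power_Suc)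
qed auto

section \<open>Sieving in residue classes\<close>

lemma card_residue_class:
  assumes "d > 0"
  shows "\<bar>real (card {n. n < N \<and> n mod d = a mod d}) - real N / real d\<bar> \<le> 1"
proof -
  define r where "r = a mod d"
  have r: "r < d" using assms by (simp add: r_def)
  define m where "m = (N + (d - 1 - r)) div d"
  have "{n. n < N \<and> n mod d = r} = (\<lambda>k. k * d + r) ` {..<m}"
  proof (intro equalityI subsetI)
    fix n assume n: "n \<in> {n. n < N \<and> n mod d = r}"
    define k where "k = n div d"
    have nk: "n = k * d + r" using n by (auto simp: k_def)
    have "Suc k * d \<le> N + (d - 1 - r)" using nk n r by auto
    then have "Suc k \<le> m" using assms by (simp add: m_def less_eq_div_iff_mult_less_eq)
    then show "n \<in> (\<lambda>k. k * d + r) ` {..<m}" using nk by auto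
  next
    fix n assume "n \<in> (\<lambda>k. k * d + r) ` {..<m}"
    then obtain k where k: "k < m" "n = k * d + r" by auto
    then have "Suc k \<le> m" by simp
    then have "Suc k * d \<le> N + (d - 1 - r)" using assms by (simp add: m_def less_eq_div_iff_mult_less_eq)
    then have "n < N" using k r by auto
    then show "n \<in> {n. n < N \<and> n mod d = r}" using k r by simp
  qed
  moreover have "inj_on (\<lambda>k. k * d + r) {..<m}" using assms by (auto simp: inj_on_def)
  ultimately have card: "card {n. n < N \<and> n mod d = r} = m" by (simp add: card_image)
  have "m * d \<le> N + (d - 1 - r)" unfolding m_def by (rule div_times_less_eq_dividend)
  then have "m * d \<le> N + d" by linarith
  then have "real m * real d \<le> real N + real d" by (metis of_nat_add of_nat_le_iff of_nat_mult)
  moreover have "N + (d - 1 - r) < Suc m * d" unfolding m_def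
    using assms by (simp add: dividend_less_div_times)
  then have "N \<le> m * d + d" by simp
  then have "real N \<le> real m * real d + real d" by (metis of_nat_add of_nat_le_iff of_nat_mult)
  ultimately have "\<bar>real m - real N / real d\<bar> \<le> 1"
    using assms by (simp add: abs_le_iff field_simps)
  then show ?thesis using card by (simp add: r_def)
qed

lemma residue_class_refine:
  fixes d q a c :: nat
  assumes "coprime d q" "d > 0" "q > 0"
  shows "\<exists>b. \<forall>n. n mod (d * q) = b mod (d * q) \<longleftrightarrow> n mod d = a mod d \<and> n mod q = c mod q"
proof -
  obtain b where b: "[b = a] (mod d)" "[b = c] (mod q)"
    using binary_chinese_remainder_nat[OF assms(1)] by blast
  have "n mod (d * q) = b mod (d * q) \<longleftrightarrow> n mod d = a mod d \<and> n mod q = c mod q" for n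
  proof -
    have "[n = b] (mod d * q) \<longleftrightarrow> [n = b] (mod d) \<and> [n = b] (mod q)"
      using assms(1) by (metis cong_modulus_mult_nat coprime_cong_mult_nat mult.commute)
    then show ?thesis using b by (simp add: cong_def)
  qed
  then show ?thesis by blast
qed

text \<open>The product of \<open>1 - sieve_weight n q\<close> over the primes \<open>q \<le> z\<close> vanishes unless \<open>n\<close> is free of
  primes up to \<open>z\<close>, and then halves for each such prime dividing \<open>n + 1\<close>.\<close>
definition sieve_weight :: "nat \<Rightarrow> nat \<Rightarrow> real" where
  "sieve_weight n q = (if q dvd n then 1 else if q dvd n + 1 then 1 / 2 else 0)"

lemma sieve_weight_bounds: "0 \<le> sieve_weight n q" "sieve_weight n q \<le> 1"
  by (auto simp: sieve_weight_def)

text \<open>General \<open>d\<close> and \<open>a\<close> are needed because the head prime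
  \<open>q\<close> refines the class: \<open>q dvd n\<close> and \<open>q dvd n + 1\<close> each
  single out one class modulo \<open>d * q\<close>, the second with half weight. Hence the local
  density \<open>1 / q + 1 / 2 * (1 / q) = 3 / (2 * q)\<close>. Each class count is off by at most
  1, and the right-hand side accumulates these errors.\<close>

lemma sum_truncated_prod_residue_class:
  assumes "distinct qs" "\<forall>q\<in>set qs. prime q \<and> coprime d q" "d > 0"
  shows "\<bar>(\<Sum>n | n < N \<and> n mod d = a mod d. truncated_prod (sieve_weight n) qs k)
            - real N / real d * truncated_prod (\<lambda>q. 3 / (2 * real q)) qs k\<bar>
         \<le> (1 + 3 / 2 * real (length qs)) ^ k"
  using assms
proof (induction qs arbitrary: d a k)
  case Nil
  then show ?case using card_residue_class[of d N a] by simp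
next
  case (Cons q qs)
  show ?case
  proof (cases k)
    case 0
    then show ?thesis using Cons card_residue_class[of d N a] by simp
  next
    case (Suc k')
    have q: "prime q" "coprime d q" using Cons.prems by auto
    have q0: "q > 0" using q by (simp add: prime_gt_0_nat)
    have q1: "q > 1" using q prime_gt_1_nat by blast
    define S where "S = (\<lambda>d a k. \<Sum>n | n < N \<and> n mod d = a mod d. truncated_prod (sieve_weight n) qs k)"
    define M where "M = truncated_prod (\<lambda>q. 3 / (2 * real q)) qs"
    define R where "R = (\<lambda>k. (1 + 3 / 2 * real (length qs)) ^ k)"
    have IH: "\<bar>S d' a' k - real N / real d' * M k\<bar> \<le> R k"
      if "d' > 0" "\<forall>q\<in>set qs. coprime d' q" for d' a' k
      unfolding S_def M_def R_def using that Cons by (intro Cons.IH) auto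
    obtain b where b: "\<And>n. n mod (d * q) = b mod (d * q) \<longleftrightarrow> n mod d = a mod d \<and> n mod q = 0 mod q"
      using residue_class_refine[of d q a 0] q q0 Cons.prems by auto
    \<comment> \<open>The class of -1 modulo \<open>q\<close>, written as \<open>q - 1\<close> to
      stay within the naturals.\<close>
    obtain c where c: "\<And>n. n mod (d * q) = c mod (d * q) \<longleftrightarrow> n mod d = a mod d \<and> n mod q = (q - 1) mod q"
      using residue_class_refine[of d q a "q - 1"] q q0 Cons.prems by auto
    have minus1: "n mod q = (q - 1) mod q \<longleftrightarrow> q dvd n + 1" for n
      using q1 by (auto simp: mod_eq_0_iff_dvd[symmetric] mod_Suc)
    have not_both: "\<not> (q dvd n \<and> q dvd n + 1)" for n
      using q1 by (metis coprime_Suc_right_nat coprime_common_divisor_nat less_irrefl Suc_eq_plus1)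
    let ?T = "\<lambda>n. truncated_prod (sieve_weight n) qs k'"
    have "(\<Sum>n | n < N \<and> n mod d = a mod d. sieve_weight n q * ?T n)
        = (\<Sum>n | n < N \<and> n mod d = a mod d.
             (if q dvd n then ?T n else 0) + 1 / 2 * (if q dvd n + 1 then ?T n else 0))"
      using not_both by (intro sum.cong) (auto simp: sieve_weight_def)
    also have "\<dots> = (\<Sum>n | n < N \<and> n mod d = a mod d. if q dvd n then ?T n else 0)
        + 1 / 2 * (\<Sum>n | n < N \<and> n mod d = a mod d. if q dvd n + 1 then ?T n else 0)"
      by (simp add: sum.distrib sum_distrib_left)
    also have "(\<Sum>n | n < N \<and> n mod d = a mod d. if q dvd n then ?T n else 0) = S (d * q) b k'"
    proof -
      have "{n. n < N \<and> n mod (d * q) = b mod (d * q)} = {n \<in> {n. n < N \<and> n mod d = a mod d}. q dvd n}"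
        by (auto simp: b mod_eq_0_iff_dvd)
      then show ?thesis unfolding S_def by (simp only:) (intro sum.inter_filter[symmetric], simp)
    qed
    also have "(\<Sum>n | n < N \<and> n mod d = a mod d. if q dvd n + 1 then ?T n else 0) = S (d * q) c k'"
    proof -
      have "{n. n < N \<and> n mod (d * q) = c mod (d * q)} = {n \<in> {n. n < N \<and> n mod d = a mod d}. q dvd n + 1}"
        unfolding c minus1 by auto
      then show ?thesis unfolding S_def by (simp only:) (intro sum.inter_filter[symmetric], simp)
    qed
    finally have split: "(\<Sum>n | n < N \<and> n mod d = a mod d. truncated_prod (sieve_weight n) (q # qs) (Suc k'))
        = S d a (Suc k') - (S (d * q) b k' + 1 / 2 * S (d * q) c k')"
      by (simp add: sum_subtractf S_def)
    have cop: "\<forall>q'\<in>set qs. coprime d q'" using Cons.prems by auto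
    have cop': "\<forall>q'\<in>set qs. coprime (d * q) q'"
    proof
      fix q' assume q': "q' \<in> set qs"
      then have "coprime q q'" using Cons.prems by (intro primes_coprime) auto
      then show "coprime (d * q) q'" using cop q' by simp
    qed
    have i1: "\<bar>S d a (Suc k') - real N / real d * M (Suc k')\<bar> \<le> R (Suc k')"
      using Cons.prems cop by (intro IH) auto
    have i2: "\<bar>S (d * q) e k' - real N / real (d * q) * M k'\<bar> \<le> R k'" for e
      using Cons.prems cop' q0 by (intro IH) auto
    have main: "real N / real d * truncated_prod (\<lambda>q. 3 / (2 * real q)) (q # qs) (Suc k')
        = real N / real d * M (Suc k') - 3 / 2 * (real N / real (d * q) * M k')"
    proof -
      have "truncated_prod (\<lambda>q. 3 / (2 * real q)) (q # qs) (Suc k') = M (Suc k') - 3 / (2 * real q) * M k'"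
        by (simp add: M_def)
      then show ?thesis by (simp add: right_diff_distrib mult_ac)
    qed
    have arith: "\<bar>s1 - (s2 + 1 / 2 * s3) - (m1 - 3 / 2 * m2)\<bar> \<le> r1 + 3 / 2 * r2"
      if "\<bar>s1 - m1\<bar> \<le> r1" "\<bar>s2 - m2\<bar> \<le> r2" "\<bar>s3 - m2\<bar> \<le> r2" for s1 s2 s3 m1 m2 r1 r2 :: real
      using that by linarith
    have "\<bar>(\<Sum>n | n < N \<and> n mod d = a mod d. truncated_prod (sieve_weight n) (q # qs) (Suc k'))
         - real N / real d * truncated_prod (\<lambda>q. 3 / (2 * real q)) (q # qs) (Suc k')\<bar>
      \<le> R (Suc k') + 3 / 2 * R k'"
      unfolding split main by (rule arith[OF i1 i2 i2])
    also have "\<dots> \<le> (1 + 3 / 2 * real (length (q # qs))) ^ Suc k'"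
    proof -
      let ?x = "1 + 3 / 2 * real (length qs)"
      have "3 / 2 * ?x ^ k' \<le> real (Suc k') * (3 / 2) * ?x ^ k'"
        by (intro mult_right_mono) auto
      then have "R (Suc k') + 3 / 2 * R k' \<le> ?x ^ Suc k' + real (Suc k') * (3 / 2) * ?x ^ k'"
        unfolding R_def by linarith
      also have "\<dots> \<le> (?x + 3 / 2) ^ Suc k'"
        by (intro power_Suc_add_ge) auto
      also have "?x + 3 / 2 = 1 + 3 / 2 * real (length (q # qs))" by (simp add: field_simps)
      finally show ?thesis .
    qed
    finally show ?thesis unfolding Suc .
  qed
qed

lemma brun_sieve:
  assumes fin: "finite P" and pr: "\<And>p. p \<in> P \<Longrightarrow> prime p" and k: "even k"
  shows "(\<Sum>n<N. \<Prod>q\<in>P. 1 - sieve_weight n q)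
     \<le> real N * ((\<Prod>q\<in>P. 1 - 3 / (2 * real q)) + (\<Sum>q\<in>P. 3 / (2 * real q)) ^ Suc k / fact (Suc k))
       + (1 + 3 / 2 * real (card P)) ^ k"
proof -
  define qs where "qs = sorted_list_of_set P"
  have qs: "distinct qs" "set qs = P" "length qs = card P" using fin by (auto simp: qs_def)
  have prod: "(\<Prod>q\<in>P. f q) = (\<Prod>q\<leftarrow>qs. f q)" for f :: "nat \<Rightarrow> real"
    using prod.distinct_set_conv_list[OF qs(1), of f] qs by simp
  have sum: "(\<Sum>q\<in>P. f q) = (\<Sum>q\<leftarrow>qs. f q)" for f :: "nat \<Rightarrow> real"
    using sum.distinct_set_conv_list[OF qs(1), of f] qs by simp
  let ?M = "truncated_prod (\<lambda>q. 3 / (2 * real q)) qs k"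
  have "(\<Sum>n<N. \<Prod>q\<in>P. 1 - sieve_weight n q) \<le> (\<Sum>n<N. truncated_prod (sieve_weight n) qs k)"
    unfolding prod using bonferroni[of qs _ k] k sieve_weight_bounds by (intro sum_mono) auto
  also have "\<dots> \<le> real N * ?M + (1 + 3 / 2 * real (card P)) ^ k"
  proof -
    have "{n. n < N \<and> n mod 1 = 0 mod 1} = {..<N}" by auto
    moreover have "\<bar>(\<Sum>n | n < N \<and> n mod 1 = 0 mod 1. truncated_prod (sieve_weight n) qs k)
            - real N / real 1 * ?M\<bar> \<le> (1 + 3 / 2 * real (length qs)) ^ k"
      using qs pr by (intro sum_truncated_prod_residue_class) auto
    ultimately have "\<bar>(\<Sum>n<N. truncated_prod (sieve_weight n) qs k) - real N * ?M\<bar>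
        \<le> (1 + 3 / 2 * real (card P)) ^ k"
      using qs(3) by simp
    then show ?thesis by linarith
  qed
  also have "?M \<le> (\<Prod>q\<in>P. 1 - 3 / (2 * real q)) + (\<Sum>q\<in>P. 3 / (2 * real q)) ^ Suc k / fact (Suc k)"
  proof -
    have "\<forall>q\<in>set qs. 0 \<le> 3 / (2 * real q) \<and> 3 / (2 * real q) \<le> 1"
    proof
      fix q assume "q \<in> set qs"
      then have "real q \<ge> 2" using pr qs prime_ge_2_nat[of q] by simp
      then show "0 \<le> 3 / (2 * real q) \<and> 3 / (2 * real q) \<le> 1" by (simp add: field_simps)
    qed
    from truncated_prod_approx[OF this, of k] show ?thesis
      unfolding prod sum by (simp add: abs_le_iff)
  qed
  finally show ?thesis by (simp add: mult_left_mono)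
qed

text \<open>This is \<open>2^(-omega(p + 1))\<close>. If the product of \<open>p + 1\<close> over a
  set of primes divides \<open>v > 0\<close>, the product of these weights is at least
  \<open>2^(-Omega(v))\<close>, so a value with few prime factors forces it to be large.\<close>

definition shift_weight :: "nat \<Rightarrow> real" where
  "shift_weight p = (1 / 2) ^ card (prime_factors (p + 1))"

lemma shift_weight_bounds: "0 \<le> shift_weight p" "shift_weight p \<le> 1"
  by (auto simp: shift_weight_def power_le_one)

text \<open>No prime \<open>q <= z\<close> divides the prime \<open>p > z\<close>, so only the
  factors 1/2 for \<open>q dvd p + 1\<close> remain; ignoring the prime divisors of
  \<open>p + 1\<close> above \<open>z\<close> can only increase the product.\<close>

lemma shift_weight_le_sieve:
  assumes p: "prime p" "real p > z"
  shows "shift_weight p \<le> (\<Prod>q | prime q \<and> real q \<le> z. 1 - sieve_weight p q)"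
proof -
  define P where "P = {q. prime q \<and> real q \<le> z}"
  have "P \<subseteq> {..p}" unfolding P_def using p by auto
  then have fin: "finite P" using finite_subset by blast
  have "(\<Prod>q\<in>P. 1 - sieve_weight p q) = (\<Prod>q\<in>P. if q dvd p + 1 then 1 / 2 else 1)"
  proof (rule prod.cong[OF refl])
    fix q assume q: "q \<in> P"
    then have "\<not> q dvd p" using p primes_dvd_imp_eq[of q p] by (auto simp: P_def)
    then show "1 - sieve_weight p q = (if q dvd p + 1 then 1 / 2 else 1)"
      by (simp add: sieve_weight_def)
  qed
  also have "\<dots> = (\<Prod>q\<in>{q\<in>P. q dvd p + 1}. 1 / 2)"
    by (rule prod.inter_filter[OF fin, symmetric])
  also have "\<dots> = (1 / 2) ^ card {q\<in>P. q dvd p + 1}" by simp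
  also have "\<dots> \<ge> shift_weight p"
    unfolding shift_weight_def
    by (intro power_decreasing card_mono) (auto simp: P_def in_prime_factors_iff)
  finally show ?thesis unfolding P_def .
qed

text \<open>Primes up to \<open>z\<close> are counted trivially; beyond \<open>z\<close> the sieve
  product is nonnegative, so the sum may run over all \<open>n < N\<close>. The constant 9 is 3/2
  times the 6 of \<open>sum_inverse_primes_le\<close>.\<close>

lemma sum_shift_weight_sieve:
  fixes z :: real
  assumes z: "z \<ge> 3" and k: "even k"
  shows "(\<Sum>p | prime p \<and> p < N. shift_weight p)
     \<le> z + (real N * (ln z powr - (3/2) + (9 * ln (1 + ln z)) ^ Suc k / fact (Suc k))
       + (1 + 3 / 2 * z) ^ k)"
proof -
  define P where "P = {q. prime q \<and> real q \<le> z}"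
  have sub: "P \<subseteq> {1..nat \<lfloor>z\<rfloor>}"
    unfolding P_def using z by (auto simp: le_nat_floor Suc_le_eq prime_gt_0_nat)
  then have fin: "finite P" using finite_subset by blast
  have "card P \<le> nat \<lfloor>z\<rfloor>" using card_mono[OF _ sub] by simp
  then have cardP: "real (card P) \<le> z" using z by linarith
  have "(\<Sum>p | prime p \<and> p < N. shift_weight p)
      \<le> (\<Sum>p\<in>P \<union> {p. prime p \<and> real p > z \<and> p < N}. shift_weight p)"
    using fin by (intro sum_mono2) (auto simp: P_def shift_weight_bounds)
  also have "\<dots> \<le> (\<Sum>p\<in>P. shift_weight p) + (\<Sum>p | prime p \<and> real p > z \<and> p < N. shift_weight p)"
    using fin by (subst sum_Un) (auto intro!: sum_nonneg simp: shift_weight_bounds)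
  also have "(\<Sum>p\<in>P. shift_weight p) \<le> (\<Sum>p\<in>P. 1)"
    by (intro sum_mono shift_weight_bounds)
  also have "\<dots> \<le> z" using cardP by simp
  also have "(\<Sum>p | prime p \<and> real p > z \<and> p < N. shift_weight p)
      \<le> (\<Sum>p | prime p \<and> real p > z \<and> p < N. \<Prod>q\<in>P. 1 - sieve_weight p q)"
    unfolding P_def by (intro sum_mono shift_weight_le_sieve) auto
  also have "\<dots> \<le> (\<Sum>n<N. \<Prod>q\<in>P. 1 - sieve_weight n q)"
    by (intro sum_mono2) (auto intro!: prod_nonneg simp: sieve_weight_bounds)
  also have "\<dots> \<le> real N * ((\<Prod>q\<in>P. 1 - 3 / (2 * real q)) + (\<Sum>q\<in>P. 3 / (2 * real q)) ^ Suc k / fact (Suc k))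
       + (1 + 3 / 2 * real (card P)) ^ k"
    by (rule brun_sieve) (use fin k in \<open>auto simp: P_def\<close>)
  also have "\<dots> \<le> real N * (ln z powr - (3/2) + (9 * ln (1 + ln z)) ^ Suc k / fact (Suc k))
       + (1 + 3 / 2 * z) ^ k"
  proof (intro add_mono mult_left_mono divide_right_mono power_mono)
    show "(\<Prod>q\<in>P. 1 - 3 / (2 * real q)) \<le> ln z powr - (3/2)"
      unfolding P_def using z by (rule prod_one_minus_inverse_primes_le)
    have "(\<Sum>q\<in>P. 3 / (2 * real q)) = 3 / 2 * (\<Sum>q\<in>P. 1 / real q)"
      by (simp add: sum_distrib_left)
    also have "\<dots> \<le> 3 / 2 * (6 * ln (1 + ln z))"
      unfolding P_def using z by (intro mult_left_mono sum_inverse_primes_le) auto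
    finally show "(\<Sum>q\<in>P. 3 / (2 * real q)) \<le> 9 * ln (1 + ln z)" by simp
  qed (use cardP in \<open>auto intro: sum_nonneg\<close>)
  finally show ?thesis by simp
qed

lemma power_div_fact_le_exp:
  fixes x :: real
  assumes "x \<ge> 0"
  shows "x ^ k / fact k \<le> exp x"
proof -
  have "(\<Sum>i\<in>{k}. x ^ i /\<^sub>R fact i) \<le> (\<Sum>i. x ^ i /\<^sub>R fact i)"
    using assms summable_exp_generic[of x] by (intro sum_le_suminf) auto
  then show ?thesis by (simp add: exp_def divide_inverse mult.commute)
qed

lemma sum_shift_weight_le:
  "\<forall>\<^sub>F N in at_top. (\<Sum>p | prime p \<and> p < N. shift_weight p) \<le> 2 * real N / ln (real N) powr (13/10)"
proof -
  \<comment> \<open>Balances two demands: \<open>(ln z) powr - (3/2)\<close> is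
    \<open>(ln x) powr - (27/20)\<close>, better than the required exponent
    \<open>- (13/10)\<close>, while \<open>z\<close> to a power of order \<open>ln (ln x)\<close>
    still grows more slowly than any positive power of \<open>x\<close>.\<close>
  define z where "z = (\<lambda>x::real. exp (ln x powr (9/10)))"
  define l where "l = (\<lambda>x::real. ln (1 + ln x))"
  have asymp: "\<forall>\<^sub>F x::real in at_top. z x + (x * ((ln x powr (9/10)) powr - (3/2) + (1 + ln x) powr - 72)
       + (1 + 3 / 2 * z x) powr (72 * l x + 2)) \<le> 2 * x / ln x powr (13/10)"
    unfolding z_def l_def by real_asymp
  have z3: "\<forall>\<^sub>F x::real in at_top. z x \<ge> 3 \<and> z x \<le> x \<and> x \<ge> 3"
    unfolding z_def by (intro eventually_conj; real_asymp)
  have main: "(\<Sum>p | prime p \<and> p < N. shift_weight p) \<le> 2 * real N / ln (real N) powr (13/10)"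
    if a: "z (real N) + (real N * ((ln (real N) powr (9/10)) powr - (3/2) + (1 + ln (real N)) powr - 72)
       + (1 + 3 / 2 * z (real N)) powr (72 * l (real N) + 2)) \<le> 2 * real N / ln (real N) powr (13/10)"
      and b: "z (real N) \<ge> 3 \<and> z (real N) \<le> real N \<and> real N \<ge> 3" for N
  proof -
    define x where "x = real N"
    have lx: "ln x > 0" using b by (simp add: x_def)
    have lpos: "l x > 0" using lx by (simp add: l_def)
    \<comment> \<open>Even, as the sieve requires, and large against \<open>s\<close>: since
      \<open>8 >= exp 2\<close>, the tail is at most
      \<open>exp (8 * s) / 8 ^ Suc k <= exp (72 * l x - 144 * l x)\<close>.\<close>
    define k where "k = 2 * nat \<lceil>36 * l x\<rceil>"
    have k1: "real k \<ge> 72 * l x" and k2: "real k \<le> 72 * l x + 2"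
      unfolding k_def using lpos by linarith+
    have lz: "ln (z x) = ln x powr (9/10)" by (simp add: z_def)
    have lz0: "ln (z x) \<ge> 0" using b by (simp add: x_def)
    have lzx: "ln (z x) \<le> ln x" using b by (simp add: x_def)
    define s where "s = 9 * ln (1 + ln (z x))"
    have s0: "s \<ge> 0" using lz0 by (simp add: s_def)
    have sl: "8 * s \<le> 72 * l x" using lz0 lzx by (simp add: s_def l_def)
    have tail: "s ^ Suc k / fact (Suc k) \<le> (1 + ln x) powr - 72"
    proof -
      have "8 ^ Suc k * (s ^ Suc k / fact (Suc k)) = (8 * s) ^ Suc k / fact (Suc k)"
        by (simp add: power_mult_distrib)
      also have "\<dots> \<le> exp (8 * s)" using s0 by (intro power_div_fact_le_exp) simp
      also have "\<dots> \<le> exp (72 * l x)" using sl by simp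
      finally have 1: "8 ^ Suc k * (s ^ Suc k / fact (Suc k)) \<le> exp (72 * l x)" .
      have e2: "exp 2 \<le> (8::real)"
      proof -
        have "exp 2 = exp 1 * exp (1::real)" by (simp flip: exp_add)
        also have "\<dots> \<le> (272/100) * (272/100)" using e_less_272 by (intro mult_mono) auto
        finally show ?thesis by simp
      qed
      have "exp (144 * l x) \<le> exp (2 * real (Suc k))" using k1 by simp
      also have "\<dots> = exp 2 ^ Suc k" by (metis exp_of_nat_mult mult.commute)
      also have "\<dots> \<le> 8 ^ Suc k" using e2 by (intro power_mono) auto
      finally have 2: "exp (144 * l x) \<le> 8 ^ Suc k" .
      have "exp (144 * l x) * (s ^ Suc k / fact (Suc k)) \<le> 8 ^ Suc k * (s ^ Suc k / fact (Suc k))"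
        using s0 2 by (intro mult_right_mono) auto
      with 1 have "exp (144 * l x) * (s ^ Suc k / fact (Suc k)) \<le> exp (72 * l x)" by linarith
      then have "s ^ Suc k / fact (Suc k) \<le> exp (72 * l x) / exp (144 * l x)"
        by (simp add: field_simps)
      also have "\<dots> = exp (- 72 * l x)" by (simp flip: exp_diff)
      also have "\<dots> = (1 + ln x) powr - 72" using lx by (simp add: powr_def l_def)
      finally show ?thesis .
    qed
    have pw: "(1 + 3 / 2 * z x) ^ k \<le> (1 + 3 / 2 * z x) powr (72 * l x + 2)"
    proof -
      have z1: "1 + 3 / 2 * z x \<ge> 1" using b by (simp add: x_def)
      then have "(1 + 3 / 2 * z x) ^ k = (1 + 3 / 2 * z x) powr real k" by (simp add: powr_realpow)
      also have "\<dots> \<le> (1 + 3 / 2 * z x) powr (72 * l x + 2)" using z1 k2 by (intro powr_mono) auto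
      finally show ?thesis .
    qed
    have "even k" by (simp add: k_def)
    then have "(\<Sum>p | prime p \<and> p < N. shift_weight p)
     \<le> z x + (real N * (ln (z x) powr - (3/2) + s ^ Suc k / fact (Suc k)) + (1 + 3 / 2 * z x) ^ k)"
      unfolding s_def using b by (intro sum_shift_weight_sieve) (auto simp: x_def)
    also have "\<dots> \<le> z x + (real N * (ln (z x) powr - (3/2) + (1 + ln x) powr - 72)
        + (1 + 3 / 2 * z x) powr (72 * l x + 2))"
      using tail pw by (intro add_mono mult_left_mono) auto
    also have "\<dots> \<le> 2 * real N / ln (real N) powr (13/10)"
      using a unfolding x_def[symmetric] lz .
    finally show ?thesis .
  qed
  have "\<forall>\<^sub>F N in at_top. z (real N) + (real N * ((ln (real N) powr (9/10)) powr - (3/2) + (1 + ln (real N)) powr - 72)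
       + (1 + 3 / 2 * z (real N)) powr (72 * l (real N) + 2)) \<le> 2 * real N / ln (real N) powr (13/10)"
    using eventually_compose_filterlim[OF asymp filterlim_real_sequentially] .
  moreover have "\<forall>\<^sub>F N in at_top. z (real N) \<ge> 3 \<and> z (real N) \<le> real N \<and> real N \<ge> 3"
    using eventually_compose_filterlim[OF z3 filterlim_real_sequentially] .
  ultimately show ?thesis by eventually_elim (rule main)
qed

text \<open>Dyadic blocks: the primes from \<open>2 ^ i\<close> to \<open>2 ^ Suc i\<close>
  contribute at most \<open>b i\<close>, which is of order at most
  \<open>(i + 1) powr - (13/10)\<close>, a summable sequence.\<close>

lemma sum_shift_weight_over_p_bounded:
  "\<exists>S. \<forall>N. (\<Sum>p | prime p \<and> p \<le> N. shift_weight p / real p) \<le> S"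
proof -
  define b where "b = (\<lambda>i::nat. (\<Sum>p | prime p \<and> p < 2 ^ Suc i. shift_weight p) / 2 ^ i)"
  have b0: "b i \<ge> 0" for i
    unfolding b_def by (intro divide_nonneg_nonneg sum_nonneg) (auto simp: shift_weight_bounds)
  have "filterlim (\<lambda>i::nat. 2 ^ Suc i :: nat) at_top at_top"
  proof (rule filterlim_at_top_mono[OF filterlim_ident], rule always_eventually, rule allI)
    show "n \<le> 2 ^ Suc n" for n :: nat using less_exp[of "Suc n"] by linarith
  qed
  from eventually_compose_filterlim[OF sum_shift_weight_le this]
  have "\<forall>\<^sub>F i in at_top. norm (b i) \<le> 4 / ln 2 powr (13/10) * (1 / real (Suc i) powr (13/10))"
  proof eventually_elim
    case (elim i)
    have "ln (real (2 ^ Suc i)) = real (Suc i) * ln 2" by (simp only: of_nat_power of_nat_numeral ln_realpow)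
    then have "ln (real (2 ^ Suc i)) powr (13/10) = real (Suc i) powr (13/10) * ln 2 powr (13/10)"
      by (simp only: powr_mult)
    with elim have "(\<Sum>p | prime p \<and> p < 2 ^ Suc i. shift_weight p)
        \<le> 4 * 2 ^ i / (real (Suc i) powr (13/10) * ln 2 powr (13/10))"
      by simp
    then have "b i \<le> (4 * 2 ^ i / (real (Suc i) powr (13/10) * ln 2 powr (13/10))) / 2 ^ i"
      unfolding b_def by (intro divide_right_mono) auto
    also have "\<dots> = 4 / ln 2 powr (13/10) * (1 / real (Suc i) powr (13/10))" by simp
    finally show ?case using b0[of i] by simp
  qed
  moreover have "summable (\<lambda>i. 4 / ln 2 powr (13/10) * (1 / real (Suc i) powr (13/10)))"
  proof (rule summable_mult)
    have "summable (\<lambda>i. real i powr - (13/10))" by (simp add: summable_real_powr_iff)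
    then have "summable (\<lambda>i. real (Suc i) powr - (13/10))" by (subst summable_Suc_iff)
    then show "summable (\<lambda>i. 1 / real (Suc i) powr (13/10))" by (simp add: powr_minus_divide)
  qed
  ultimately have sum: "summable b" by (rule summable_comparison_test_ev)
  have part: "(\<Sum>p | prime p \<and> p < 2 ^ I. shift_weight p / real p) \<le> (\<Sum>i<I. b i)" for I
  proof (induction I)
    case 0
    have "{p::nat. prime p \<and> p < 2 ^ 0} = {}" by (auto dest: prime_gt_0_nat)
    then show ?case by simp
  next
    case (Suc I)
    have "{p::nat. prime p \<and> p < 2 ^ Suc I} = {p. prime p \<and> p < 2 ^ I} \<union> {p. prime p \<and> 2 ^ I \<le> p \<and> p < 2 ^ Suc I}"
      by auto
    then have "(\<Sum>p | prime p \<and> p < 2 ^ Suc I. shift_weight p / real p)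
      = (\<Sum>p | prime p \<and> p < 2 ^ I. shift_weight p / real p)
        + (\<Sum>p | prime p \<and> 2 ^ I \<le> p \<and> p < 2 ^ Suc I. shift_weight p / real p)"
      by (simp only:) (rule sum.union_disjoint, auto)
    also have "(\<Sum>p | prime p \<and> 2 ^ I \<le> p \<and> p < 2 ^ Suc I. shift_weight p / real p)
      \<le> (\<Sum>p | prime p \<and> 2 ^ I \<le> p \<and> p < 2 ^ Suc I. shift_weight p / 2 ^ I)"
    proof (intro sum_mono divide_left_mono)
      fix p :: nat assume p: "p \<in> {p. prime p \<and> 2 ^ I \<le> p \<and> p < 2 ^ Suc I}"
      then have "real (2 ^ I) \<le> real p" by (simp only: of_nat_le_iff) simp
      then show "2 ^ I \<le> real p" by simp
      with p show "0 < real p * 2 ^ I" by (auto simp: prime_gt_0_nat)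
    qed (auto simp: shift_weight_bounds)
    also have "\<dots> \<le> (\<Sum>p | prime p \<and> p < 2 ^ Suc I. shift_weight p / 2 ^ I)"
      by (intro sum_mono2) (auto simp: shift_weight_bounds)
    also have "\<dots> = b I" by (simp add: b_def sum_divide_distrib)
    finally show ?case using Suc by simp
  qed
  have "(\<Sum>p | prime p \<and> p \<le> N. shift_weight p / real p) \<le> suminf b" for N
  proof -
    have "(\<Sum>p | prime p \<and> p \<le> N. shift_weight p / real p)
      \<le> (\<Sum>p | prime p \<and> p < 2 ^ N. shift_weight p / real p)"
      by (intro sum_mono2) (auto simp: shift_weight_bounds intro: le_less_trans less_exp)
    also have "\<dots> \<le> (\<Sum>i<N. b i)" by (rule part)
    also have "\<dots> \<le> suminf b" using sum b0 by (intro sum_le_suminf) auto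
    finally show ?thesis .
  qed
  then show ?thesis by blast
qed

section \<open>The upper bound\<close>

text \<open>A new prime with exponent 1 enters \<open>K\<close> and at most cubes the number, by
  \<open>divsum_le_square\<close>. A new power with \<open>e >= 2\<close> is charged to
  \<open>d\<close> through \<open>p ^ (e div 2)\<close>, and \<open>e <= 3 * (e div 2)\<close>
  explains the cube on \<open>d\<close>. Thus a large \<open>m\<close> has a large square divisor or
  many simple primes.\<close>

lemma chain_practical_structure:
  assumes "chain_practical m"
  shows "\<exists>d K. d > 0 \<and> d ^ 2 dvd m \<and> finite K \<and> (\<forall>p\<in>K. prime p \<and> p dvd m)
    \<and> 2 * m \<le> (2 * d ^ 3) ^ (3 ^ card K) \<and> (\<Prod>p\<in>K. p + 1) dvd divsum m"
  using assms
proof (induction rule: chain_practical.induct)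
  case one
  show ?case by (rule exI[of _ 1], rule exI[of _ "{}"]) simp
next
  case (step n p e)
  then obtain d K where d: "d > 0" "d ^ 2 dvd n" and K: "finite K" "\<And>q. q \<in> K \<Longrightarrow> prime q \<and> q dvd n"
    and le: "2 * n \<le> (2 * d ^ 3) ^ (3 ^ card K)" and dv: "(\<Prod>q\<in>K. q + 1) dvd divsum n"
    by blast
  have n: "n > 0" using step chain_practical_pos by blast
  have p0: "p > 0" using step prime_gt_0_nat by blast
  have pK: "p \<notin> K" using K step by blast
  have cop: "coprime n (p ^ e)"
    using step by (metis coprime_commute coprime_power_right_iff prime_imp_coprime)
  show ?case
  proof (cases "e = 1")
    case True
    have "2 * (n * p) \<le> 2 * (n * (2 * n ^ 2))"
      using step.hyps(4) divsum_le_square[OF n] by (intro mult_le_mono) auto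
    also have "\<dots> \<le> (2 * n) ^ 3" by (simp add: power3_eq_cube power2_eq_square)
    also have "\<dots> \<le> ((2 * d ^ 3) ^ (3 ^ card K)) ^ 3" using le by (intro power_mono) auto
    also have "\<dots> = (2 * d ^ 3) ^ (3 ^ card (insert p K))"
      by (simp only: card_insert_disjoint[OF K(1) pK] power_Suc2 power_mult[symmetric])
    finally have "2 * (n * p) \<le> (2 * d ^ 3) ^ (3 ^ card (insert p K))" .
    moreover have "(\<Prod>q\<in>insert p K. q + 1) dvd divsum (n * p)"
    proof -
      have "divsum (n * p) = (p + 1) * divsum n"
        using cop True divsum_prime[OF step.hyps(2)] by (simp add: divsum_coprime_mult)
      moreover have "(\<Prod>q\<in>insert p K. q + 1) = (p + 1) * (\<Prod>q\<in>K. q + 1)"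
        using K(1) pK by (rule prod.insert)
      ultimately show ?thesis using dv by (simp only: mult_dvd_mono dvd_refl)
    qed
    moreover have "\<forall>q\<in>insert p K. prime q \<and> q dvd n * p" using K step by auto
    ultimately show ?thesis using d K True
      by (intro exI[of _ d] exI[of _ "insert p K"]) auto
  next
    case False
    then have e: "e \<ge> 2" using step by simp
    let ?f = "e div 2"
    have "(d * p ^ ?f) ^ 2 dvd n * p ^ e"
      using d(2) by (simp add: power_mult_distrib mult_dvd_mono le_imp_power_dvd flip: power_mult)
    moreover have "2 * (n * p ^ e) \<le> (2 * (d * p ^ ?f) ^ 3) ^ (3 ^ card K)"
    proof -
      have "p ^ e \<le> p ^ (3 * ?f)" using p0 e by (intro power_increasing) auto
      also have "\<dots> = (p ^ ?f) ^ 3" by (simp add: mult.commute flip: power_mult)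
      also have "\<dots> \<le> ((p ^ ?f) ^ 3) ^ (3 ^ card K)" using p0 by (intro self_le_power) auto
      finally have "(2 * n) * p ^ e \<le> (2 * d ^ 3) ^ (3 ^ card K) * ((p ^ ?f) ^ 3) ^ (3 ^ card K)"
        using le by (intro mult_le_mono)
      then show ?thesis by (simp add: power_mult_distrib mult_ac)
    qed
    moreover have "(\<Prod>q\<in>K. q + 1) dvd divsum (n * p ^ e)"
      using dv cop by (simp add: divsum_coprime_mult)
    moreover have "\<forall>q\<in>K. prime q \<and> q dvd n * p ^ e" using K by auto
    ultimately show ?thesis using d K p0
      by (intro exI[of _ "d * p ^ ?f"] exI[of _ K]) auto
  qed
qed

section \<open>The exceptional sets and their sizes\<close>

lemma card_prime_factors_le_size: "card (prime_factors (n::nat)) \<le> size (prime_factorization n)"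
proof -
  have "card (prime_factors n) = (\<Sum>p\<in>prime_factors n. 1)" by simp
  also have "\<dots> \<le> (\<Sum>p\<in>prime_factors n. count (prime_factorization n) p)"
    by (intro sum_mono) (simp add: Suc_le_eq)
  finally show ?thesis by (simp add: size_multiset_overloaded_eq)
qed

text \<open>Multiplicity on the right is what makes the count additive over the factors
  \<open>p + 1\<close>, which need not be coprime.\<close>

lemma sum_card_prime_factors_le:
  assumes "finite K" "(\<Prod>p\<in>K. p + 1) dvd v" "v > (0::nat)"
  shows "(\<Sum>p\<in>K. card (prime_factors (p + 1))) \<le> size (prime_factorization v)"
proof -
  have "(\<Sum>p\<in>K. card (prime_factors (p + 1))) \<le> (\<Sum>p\<in>K. size (prime_factorization (p + 1)))"
    by (intro sum_mono card_prime_factors_le_size)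
  also have "\<dots> = size (prime_factorization (\<Prod>p\<in>K. p + 1))"
    using assms(1)
  proof (induction K rule: finite_induct)
    case (insert p K)
    have "(\<Prod>p\<in>K. p + 1) \<noteq> 0" by (simp add: insert)
    then show ?case using insert by (simp add: prime_factorization_mult del: mult_Suc)
  qed simp
  also have "\<dots> \<le> size (prime_factorization v)"
    using assms(2,3) by (intro size_mset_mono) (simp add: prime_factorization_subset_iff_dvd assms(1))
  finally show ?thesis .
qed

text \<open>Rankin's trick: on the counted set the product of \<open>1 + c * shift_weight p\<close>
  over the primes of \<open>m\<close> is at least \<open>c powr k * 2 powr - a\<close>, whereas its
  average up to \<open>N\<close> is at most \<open>exp (c * S)\<close>. With \<open>S\<close>
  independent of \<open>N\<close>, \<open>c\<close> may be taken as large as desired.\<close>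

lemma card_many_light_primes_le:
  fixes c a k :: real
  assumes c: "c \<ge> 1" and S: "(\<Sum>p | prime p \<and> p \<le> N. shift_weight p / real p) \<le> S"
  shows "real (card {m\<in>{1..N}. \<exists>K. finite K \<and> (\<forall>p\<in>K. prime p \<and> p dvd m) \<and> k \<le> real (card K)
            \<and> real (\<Sum>p\<in>K. card (prime_factors (p + 1))) \<le> a})
         \<le> real N * exp (c * S) * 2 powr a / c powr k"
proof -
  define M where "M = {m\<in>{1..N}. \<exists>K. finite K \<and> (\<forall>p\<in>K. prime p \<and> p dvd m) \<and> k \<le> real (card K)
            \<and> real (\<Sum>p\<in>K. card (prime_factors (p + 1))) \<le> a}"
  let ?g = "\<lambda>p. c * shift_weight p"
  have g: "?g p \<ge> 0" for p using c shift_weight_bounds[of p] by simp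
  have low: "c powr k * 2 powr - a \<le> (\<Prod>p\<in>prime_factors m. 1 + ?g p)" if m: "m \<in> M" for m
  proof -
    obtain K where K: "finite K" "\<And>p. p \<in> K \<Longrightarrow> prime p \<and> p dvd m" "k \<le> real (card K)"
      "real (\<Sum>p\<in>K. card (prime_factors (p + 1))) \<le> a" using m unfolding M_def by blast
    have "c powr k * 2 powr - a \<le> c ^ card K * (1 / 2) ^ (\<Sum>p\<in>K. card (prime_factors (p + 1)))"
    proof (intro mult_mono)
      have "c powr k \<le> c powr real (card K)" using c K by (intro powr_mono) auto
      then show "c powr k \<le> c ^ card K" using c by (simp add: powr_realpow)
      let ?s = "\<Sum>p\<in>K. card (prime_factors (p + 1))"
      have "2 powr - a \<le> (2::real) powr - real ?s" using K(4) by (intro powr_mono) auto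
      also have "\<dots> = (1 / 2) ^ ?s" by (simp only: powr_minus powr_realpow power_one_over inverse_eq_divide)
      finally show "2 powr - a \<le> (1 / 2 :: real) ^ ?s" .
    qed (use c in auto)
    also have "\<dots> = (\<Prod>p\<in>K. ?g p)"
      by (simp add: shift_weight_def prod.distrib power_sum)
    also have "\<dots> \<le> (\<Prod>p\<in>K. 1 + ?g p)" using g by (intro prod_mono) auto
    also have "\<dots> \<le> (\<Prod>p\<in>prime_factors m. 1 + ?g p)"
    proof (rule prod_mono2)
      show "K \<subseteq> prime_factors m" using K m by (auto simp: in_prime_factors_iff M_def)
    qed (use g in \<open>auto intro: add_nonneg_nonneg\<close>)
    finally show ?thesis .
  qed
  have "real (card M) * (c powr k * 2 powr - a) = (\<Sum>m\<in>M. c powr k * 2 powr - a)" by simp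
  also have "\<dots> \<le> (\<Sum>m\<in>M. \<Prod>p\<in>prime_factors m. 1 + ?g p)" by (rule sum_mono[OF low])
  also have "\<dots> \<le> (\<Sum>m=1..N. \<Prod>p\<in>prime_factors m. 1 + ?g p)"
    using g by (intro sum_mono2) (auto simp: M_def intro!: prod_nonneg add_nonneg_nonneg)
  also have "\<dots> \<le> real N * exp (\<Sum>p | prime p \<and> p \<le> N. ?g p / real p)"
    using g by (rule sum_prod_prime_factors_le)
  also have "(\<Sum>p | prime p \<and> p \<le> N. ?g p / real p) = c * (\<Sum>p | prime p \<and> p \<le> N. shift_weight p / real p)"
    by (simp add: sum_distrib_left)
  also have "real N * exp \<dots> \<le> real N * exp (c * S)"
    using c S by (intro mult_left_mono) auto
  finally have "real (card M) * (c powr k * 2 powr - a) \<le> real N * exp (c * S)" .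
  then show ?thesis unfolding M_def[symmetric] using c by (simp add: powr_minus field_simps)
qed

lemma card_Omega_ge_le:
  fixes a :: real
  assumes "N \<ge> 3"
  shows "real (card {v\<in>{1..N}. real (size (prime_factorization v)) \<ge> a})
      \<le> real N * (1 + ln (real N)) powr 36 / (3/2) powr a"
proof -
  define V where "V = {v\<in>{1..N}. real (size (prime_factorization v)) \<ge> a}"
  have "real (card V) * (3/2) powr a = (\<Sum>v\<in>V. (3/2) powr a)" by simp
  also have "\<dots> \<le> (\<Sum>v\<in>V. (3/2) ^ size (prime_factorization v))"
  proof (rule sum_mono)
    fix v assume "v \<in> V"
    then have "(3/2::real) powr a \<le> (3/2) powr real (size (prime_factorization v))"
      by (intro powr_mono) (auto simp: V_def)
    then show "(3/2) powr a \<le> (3/2::real) ^ size (prime_factorization v)" by (simp add: powr_realpow)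
  qed
  also have "\<dots> \<le> (\<Sum>v=1..N. (3/2) ^ size (prime_factorization v))"
    by (intro sum_mono2) (auto simp: V_def)
  also have "\<dots> \<le> real N * (1 + ln (real N)) powr 36" by (rule sum_Omega_le[OF assms])
  finally show ?thesis unfolding V_def[symmetric] by (simp add: field_simps)
qed

text \<open>An endpoint \<open>divsum m <= x\<close> has many prime factors (\<open>V1\<close>), or
  \<open>m\<close> is small (\<open>M2\<close>), has a large square divisor (\<open>M3\<close>), or
  has many primes \<open>p\<close> with few prime factors among the \<open>p + 1\<close>
  (\<open>M4\<close>). Outside these classes \<open>d <= D\<close> and
  \<open>card K < L / 4\<close>, and \<open>chain_practical_structure\<close> then contradicts
  \<open>m > sqrt x\<close>. Only \<open>V1\<close> is counted by values; for the others
  \<open>m <= divsum m\<close> allows counting \<open>m\<close>.\<close>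

lemma card_additive_endpoints_le:
  fixes A a c S x :: real
  defines "L \<equiv> ln (ln x)"
  assumes c: "c \<ge> 1" and S: "\<And>N. (\<Sum>p | prime p \<and> p \<le> N. shift_weight p / real p) \<le> S"
    and x: "x \<ge> 3" and A: "A > 0"
    and large: "ln x powr (1/2) * ln (2 * (ln x powr A + 1) ^ 3) < 1 / 2 * ln x"
  shows "real (card {m::nat. additive_endpoint m \<and> 1 \<le> m \<and> real m \<le> x})
     \<le> x * (1 + ln x) powr 36 / (3/2) powr (a * L) + sqrt x + x / ln x powr A
       + x * exp (c * S) * 2 powr (a * L) / c powr (L / 4)"
proof -
  define N where "N = nat \<lfloor>x\<rfloor>"
  have N: "N \<ge> 3" "real N \<le> x" unfolding N_def using x by (auto simp: le_nat_floor)
  have le_N: "n \<le> N" if "real n \<le> x" for n using that by (simp add: N_def le_nat_floor)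
  have lx: "ln x > 1" using x ln3_gt_1 ln_le_cancel_iff[of 3 x] by linarith
  have L0: "L > 0" using lx by (simp add: L_def)
  define D where "D = nat \<lceil>ln x powr A\<rceil>"
  have lxA: "ln x powr A > 0" using lx by simp
  have D: "ln x powr A \<le> real D" "real D \<le> ln x powr A + 1" "D > 0"
    unfolding D_def using lxA by linarith+
  define V1 where "V1 = {v\<in>{1..N}. real (size (prime_factorization v)) \<ge> a * L}"
  define M2 where "M2 = {m\<in>{1..N}. real m \<le> sqrt x}"
  define M3 where "M3 = {m\<in>{1..N}. \<exists>d>D. d ^ 2 dvd m}"
  define M4 where "M4 = {m\<in>{1..N}. \<exists>K. finite K \<and> (\<forall>p\<in>K. prime p \<and> p dvd m) \<and> L / 4 \<le> real (card K)
            \<and> real (\<Sum>p\<in>K. card (prime_factors (p + 1))) \<le> a * L}"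
  have sub: "{m::nat. additive_endpoint m \<and> 1 \<le> m \<and> real m \<le> x}
      \<subseteq> V1 \<union> divsum ` M2 \<union> divsum ` M3 \<union> divsum ` M4"
  proof
    fix v assume v: "v \<in> {m::nat. additive_endpoint m \<and> 1 \<le> m \<and> real m \<le> x}"
    then obtain m where m: "chain_practical m" "v = divsum m" by (auto simp: additive_endpoint_iff)
    have m0: "m > 0" using m chain_practical_pos by blast
    have mv: "m \<le> v" using m m0 divsum_ge by blast
    have vN: "v \<le> N" using v le_N by blast
    have mN: "m \<in> {1..N}" using m0 mv vN by auto
    obtain d K where d: "d > 0" "d ^ 2 dvd m" and K: "finite K" "\<forall>p\<in>K. prime p \<and> p dvd m"
      and le: "2 * m \<le> (2 * d ^ 3) ^ (3 ^ card K)" and dv: "(\<Prod>p\<in>K. p + 1) dvd divsum m"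
      using chain_practical_structure[OF m(1)] by blast
    show "v \<in> V1 \<union> divsum ` M2 \<union> divsum ` M3 \<union> divsum ` M4"
    proof (rule ccontr)
      assume not: "\<not> ?thesis"
      have 1: "real (size (prime_factorization v)) < a * L"
        using not v vN by (auto simp: V1_def)
      have 2: "real m > sqrt x" using not m mN by (auto simp: M2_def)
      have 3: "d \<le> D" using not m mN d by (force simp: M3_def)
      have "(\<Sum>p\<in>K. card (prime_factors (p + 1))) \<le> size (prime_factorization v)"
        using sum_card_prime_factors_le[OF K(1) dv] m v by auto
      then have "real (\<Sum>p\<in>K. card (prime_factors (p + 1))) \<le> real (size (prime_factorization v))"
        by (simp only: of_nat_le_iff)
      with 1 have weight: "real (\<Sum>p\<in>K. card (prime_factors (p + 1))) \<le> a * L" by linarith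
      have 4: "real (card K) < L / 4"
      proof (rule ccontr)
        assume "\<not> real (card K) < L / 4"
        then have "L / 4 \<le> real (card K)" by simp
        with K weight have "\<exists>K. finite K \<and> (\<forall>p\<in>K. prime p \<and> p dvd m) \<and> L / 4 \<le> real (card K)
            \<and> real (\<Sum>p\<in>K. card (prime_factors (p + 1))) \<le> a * L" by (intro exI[of _ K] conjI)
        with mN have "m \<in> M4" unfolding M4_def by (intro CollectI conjI)
        then show False using not m by blast
      qed
      have "real (2 * m) \<le> real ((2 * d ^ 3) ^ (3 ^ card K))" using le by (simp only: of_nat_le_iff)
      also have "\<dots> = (2 * real d ^ 3) ^ (3 ^ card K)" by simp
      also have "\<dots> \<le> (2 * (ln x powr A + 1) ^ 3) ^ (3 ^ card K)"
        using 3 D by (intro power_mono mult_left_mono) auto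
      finally have "ln (2 * real m) \<le> ln ((2 * (ln x powr A + 1) ^ 3) ^ (3 ^ card K))"
        using m0 by simp
      also have "\<dots> = 3 ^ card K * ln (2 * (ln x powr A + 1) ^ 3)"
        by (simp only: ln_realpow of_nat_power of_nat_numeral)
      also have "\<dots> \<le> ln x powr (1/2) * ln (2 * (ln x powr A + 1) ^ 3)"
      proof (rule mult_right_mono)
        have "(3::real) ^ card K = exp (real (card K) * ln 3)" by (simp add: exp_of_nat_mult)
        \<comment> \<open>The threshold \<open>L / 4\<close> is chosen for this: with
          \<open>ln 3 <= 2\<close> it keeps \<open>3 ^ card K\<close> below the square root of
          \<open>ln x\<close>.\<close>
        also have "\<dots> \<le> exp (L / 4 * 2)"
        proof -
          have "ln (3::real) \<le> 2" using ln_le_minus_one[of 3] by simp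
          then show ?thesis using 4 L0 by (intro exp_mono mult_mono) auto
        qed
        also have "\<dots> = ln x powr (1/2)" using lx by (simp add: powr_def L_def)
        finally show "(3::real) ^ card K \<le> ln x powr (1/2)" .
        have "2 * (ln x powr A + 1) ^ 3 \<ge> 1 * 1"
          using lxA by (intro mult_mono one_le_power) auto
        then show "0 \<le> ln (2 * (ln x powr A + 1) ^ 3)" by simp
      qed
      also have "\<dots> < 1 / 2 * ln x" by (rule large)
      also have "\<dots> = ln (sqrt x)" using x by (simp add: ln_sqrt)
      also have "\<dots> \<le> ln (2 * real m)" using 2 x by (subst ln_le_cancel_iff) (auto intro: less_imp_le simp: m0)
      finally show False by simp
    qed
  qed
  have fin: "finite V1" "finite M2" "finite M3" "finite M4"
    by (auto simp: V1_def M2_def M3_def M4_def)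
  have "card {m::nat. additive_endpoint m \<and> 1 \<le> m \<and> real m \<le> x}
      \<le> card (V1 \<union> divsum ` M2 \<union> divsum ` M3 \<union> divsum ` M4)"
    using sub fin by (intro card_mono) auto
  also have "\<dots> \<le> card V1 + card M2 + card M3 + card M4"
    using card_Un_le[of "V1 \<union> divsum ` M2 \<union> divsum ` M3" "divsum ` M4"]
      card_Un_le[of "V1 \<union> divsum ` M2" "divsum ` M3"] card_Un_le[of V1 "divsum ` M2"]
      card_image_le[OF fin(2), of divsum] card_image_le[OF fin(3), of divsum]
      card_image_le[OF fin(4), of divsum] by linarith
  finally have "real (card {m::nat. additive_endpoint m \<and> 1 \<le> m \<and> real m \<le> x})
      \<le> real (card V1) + real (card M2) + real (card M3) + real (card M4)"
    by (simp flip: of_nat_add)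
  also have "\<dots> \<le> x * (1 + ln x) powr 36 / (3/2) powr (a * L) + sqrt x + x / ln x powr A
       + x * exp (c * S) * 2 powr (a * L) / c powr (L / 4)"
  proof (intro add_mono)
    have "real (card V1) \<le> real N * (1 + ln (real N)) powr 36 / (3/2) powr (a * L)"
      unfolding V1_def by (rule card_Omega_ge_le[OF N(1)])
    also have "\<dots> \<le> x * (1 + ln x) powr 36 / (3/2) powr (a * L)"
      using N by (intro divide_right_mono mult_mono powr_mono2) auto
    finally show "real (card V1) \<le> \<dots>" .
    have "M2 \<subseteq> {1..nat \<lfloor>sqrt x\<rfloor>}" by (auto simp: M2_def le_nat_floor)
    then have "card M2 \<le> nat \<lfloor>sqrt x\<rfloor>" using card_mono[of "{1..nat \<lfloor>sqrt x\<rfloor>}" M2] by simp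
    moreover have "sqrt x \<ge> 0" using x by simp
    ultimately show "real (card M2) \<le> sqrt x" by linarith
    have "real (card M3) \<le> real N / real D"
      unfolding M3_def by (rule card_square_divisor_le[OF D(3)])
    also have "\<dots> \<le> x / ln x powr A" using N D lxA by (intro frac_le) auto
    finally show "real (card M3) \<le> x / ln x powr A" .
    have "real (card M4) \<le> real N * exp (c * S) * 2 powr (a * L) / c powr (L / 4)"
      unfolding M4_def by (rule card_many_light_primes_le[OF c S])
    also have "\<dots> \<le> x * exp (c * S) * 2 powr (a * L) / c powr (L / 4)"
      using N by (intro divide_right_mono mult_right_mono) auto
    finally show "real (card M4) \<le> \<dots>" .
  qed
  finally show ?thesis .
qed

theorem additive_endpoints_upper:
  fixes A :: real
  assumes A: "A > 0"
  shows "\<exists>C>0. \<forall>x\<ge>3. real (card {m::nat. additive_endpoint m \<and> 1 \<le> m \<and> real m \<le> x})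
                \<le> C * (x / ln x powr A)"
proof -
  obtain S where S: "\<And>N. (\<Sum>p | prime p \<and> p \<le> N. shift_weight p / real p) \<le> S"
    using sum_shift_weight_over_p_bounded by blast
  \<comment> \<open>Chosen so that \<open>(3/2) powr (a * ln (ln x))\<close> is
    \<open>ln x powr (A + 37)\<close>, which beats the factor
    \<open>(1 + ln x) powr 36\<close>.\<close>
  define a where "a = (A + 37) / ln (3/2)"
  have a: "a > 0" using A by (simp add: a_def)
  \<comment> \<open>Chosen so that \<open>c powr (ln (ln x) / 4)\<close> is
    \<open>ln x powr A * 2 powr (a * ln (ln x))\<close>, cancelling the loss in the fourth
    class.\<close>
  define c where "c = exp (4 * (A + a * ln 2))"
  have c: "c \<ge> 1" using A a by (simp add: c_def)
  define E where "E = exp (c * S)"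
  have "\<forall>\<^sub>F x::real in at_top. ln x powr (1/2) * ln (2 * (ln x powr A + 1) ^ 3) < 1 / 2 * ln x"
    using A by real_asymp
  moreover have "\<forall>\<^sub>F x::real in at_top. (1 + ln x) powr 36 / ln x powr 37 + ln x powr A * sqrt x / x + 1 + E \<le> 3 + E"
    using A by real_asymp
  ultimately have "\<forall>\<^sub>F x::real in at_top. real (card {m::nat. additive_endpoint m \<and> 1 \<le> m \<and> real m \<le> x})
                \<le> (3 + E) * (x / ln x powr A)"
    using eventually_ge_at_top[of 3]
  proof eventually_elim
    case (elim x)
    have lx: "ln x > 1" using elim(3) ln3_gt_1 ln_le_cancel_iff[of 3 x] by linarith
    have e1: "(3/2) powr (a * ln (ln x)) = ln x powr A * ln x powr 37"
    proof -
      have "a * ln (3/2) = A + 37" by (simp add: a_def)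
      then have "a * ln (ln x) * ln (3/2) = A * ln (ln x) + 37 * ln (ln x)"
        by (metis mult.commute mult.left_commute distrib_right)
      then show ?thesis using lx by (simp add: powr_def exp_add[symmetric])
    qed
    have e2: "c powr (ln (ln x) / 4) = ln x powr A * 2 powr (a * ln (ln x))"
      using lx by (simp add: powr_def c_def exp_add[symmetric] algebra_simps)
    have "real (card {m::nat. additive_endpoint m \<and> 1 \<le> m \<and> real m \<le> x})
     \<le> x * (1 + ln x) powr 36 / (3/2) powr (a * ln (ln x)) + sqrt x + x / ln x powr A
       + x * exp (c * S) * 2 powr (a * ln (ln x)) / c powr (ln (ln x) / 4)"
      using elim(3,1) A by (intro card_additive_endpoints_le[OF c S]) auto
    also have "\<dots> = ((1 + ln x) powr 36 / ln x powr 37 + ln x powr A * sqrt x / x + 1 + E) * (x / ln x powr A)"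
      unfolding e1 e2 E_def using lx elim(3) by (simp add: field_simps)
    also have "\<dots> \<le> (3 + E) * (x / ln x powr A)"
      using elim lx by (intro mult_right_mono) auto
    finally show ?case .
  qed
  then obtain x0 where x0: "\<And>x. x \<ge> x0 \<Longrightarrow> real (card {m::nat. additive_endpoint m \<and> 1 \<le> m \<and> real m \<le> x})
                \<le> (3 + E) * (x / ln x powr A)"
    by (auto simp: eventually_at_top_linorder)
  define y where "y = max 3 x0"
  \<comment> \<open>The summand \<open>ln y powr A\<close> covers \<open>3 <= x < x0\<close>, where
    the count is bounded trivially by \<open>x\<close>.\<close>
  define C where "C = 3 + E + ln y powr A"
  have "E > 0" by (simp add: E_def)
  have "real (card {m::nat. additive_endpoint m \<and> 1 \<le> m \<and> real m \<le> x}) \<le> C * (x / ln x powr A)"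
    if x: "x \<ge> 3" for x
  proof -
    have lx: "ln x > 1" using x ln3_gt_1 ln_le_cancel_iff[of 3 x] by linarith
    have q: "x / ln x powr A \<ge> 0" using x by simp
    show ?thesis
    proof (cases "x \<ge> x0")
      case True
      have "(3 + E) * (x / ln x powr A) \<le> C * (x / ln x powr A)"
        using q by (intro mult_right_mono) (auto simp: C_def)
      with x0[OF True] show ?thesis by linarith
    next
      case False
      then have xy: "x \<le> y" by (simp add: y_def)
      have "{m::nat. additive_endpoint m \<and> 1 \<le> m \<and> real m \<le> x} \<subseteq> {1..nat \<lfloor>x\<rfloor>}"
        by (auto simp: le_nat_floor)
      then have "card {m::nat. additive_endpoint m \<and> 1 \<le> m \<and> real m \<le> x} \<le> nat \<lfloor>x\<rfloor>"
        using card_mono[of "{1..nat \<lfloor>x\<rfloor>}"] by fastforce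
      then have "real (card {m::nat. additive_endpoint m \<and> 1 \<le> m \<and> real m \<le> x}) \<le> x"
        using x by linarith
      also have "\<dots> = ln x powr A * (x / ln x powr A)" using lx by simp
      also have "\<dots> \<le> C * (x / ln x powr A)"
      proof (rule mult_right_mono[OF _ q])
        have "ln x powr A \<le> ln y powr A" using xy x lx A by (intro powr_mono2) auto
        then show "ln x powr A \<le> C" using \<open>E > 0\<close> by (simp add: C_def)
      qed
      finally show ?thesis .
    qed
  qed
  moreover have "C > 0" using \<open>E > 0\<close> by (auto simp: C_def intro: add_pos_nonneg)
  ultimately show ?thesis by blast
qed

section \<open>Chebyshev's lower bound\<close>

text \<open>The subtraction rule of Leibniz's harmonic triangle; with \<open>a = n choose k\<close>
  and \<open>b = Suc n choose k\<close> it reduces to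
  \<open>(n + 1) * (b - a) = k * b\<close>.\<close>

lemma leibniz_triangle:
  assumes "1 \<le> k" "k \<le> n"
  shows "1 / (real (Suc k) * real (Suc n choose Suc k))
       = 1 / (real k * real (n choose k)) - 1 / (real k * real (Suc n choose k))"
proof -
  define a where "a = real (n choose k)"
  define b where "b = real (Suc n choose k)"
  have a0: "a > 0" using assms by (simp add: a_def)
  have b0: "b > 0" using assms by (simp add: b_def)
  have k0: "real k > 0" using assms by simp
  have r: "real (Suc n - k) = real n - real k + 1" using assms by (simp add: of_nat_diff)
  have "Suc k * (Suc n choose Suc k) = Suc n * (n choose k)"
    by (rule Suc_times_binomial)
  then have 1: "real (Suc k) * real (Suc n choose Suc k) = (real n + 1) * a"
    unfolding a_def by (metis of_nat_mult of_nat_Suc add.commute)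
  have "(Suc n - k) * (Suc n choose k) = Suc n * (n choose k)"
    using binomial_absorb_comp[of "Suc n" k] by simp
  then have 2: "(real n - real k + 1) * b = (real n + 1) * a"
    unfolding a_def b_def by (metis of_nat_mult of_nat_Suc add.commute r)
  then have 3: "(real n + 1) * (b - a) = real k * b" by (simp add: algebra_simps)
  have "1 / (real k * a) - 1 / (real k * b) = (b - a) / (real k * a * b)"
    using a0 b0 k0 by (simp add: field_simps)
  also have "\<dots> = ((real n + 1) * (b - a)) / ((real n + 1) * (real k * a * b))"
    by (simp add: divide_simps)
  also have "\<dots> = 1 / ((real n + 1) * a)"
  proof -
    have "(real n + 1) * (real k * a * b) = (real k * b) * ((real n + 1) * a)" by simp
    then show ?thesis unfolding 3 using b0 k0 by simp
  qed
  finally show ?thesis unfolding 1 a_def b_def by simp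
qed

text \<open>The entries \<open>1 / (k (n choose k))\<close> of Leibniz's harmonic triangle are integer combinations of
  \<open>1, 1/2, \<dots>, 1/n\<close>.\<close>
lemma mult_binomial_dvd_common_multiple:
  assumes "\<And>m. 1 \<le> m \<Longrightarrow> m \<le> N \<Longrightarrow> m dvd L" "1 \<le> k" "k \<le> n" "n \<le> N"
  shows "real L / (real k * real (n choose k)) \<in> \<int>"
  using assms(2-4)
proof (induction k arbitrary: n)
  case (Suc k)
  show ?case
  proof (cases "k = 0")
    case True
    have "n dvd L" using Suc.prems assms(1) by auto
    then show ?thesis using True by (auto elim!: dvdE)
  next
    case False
    then obtain n' where n: "n = Suc n'" using Suc.prems by (cases n) auto
    have "real L / (real (Suc k) * real (Suc n' choose Suc k))
        = real L / (real k * real (n' choose k)) - real L / (real k * real (Suc n' choose k))"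
      using leibniz_triangle[of k n'] False Suc.prems n
      by (metis (no_types, opaque_lifting) One_nat_def Suc_le_eq Suc_le_mono divide_inverse inverse_eq_divide
          neq0_conv right_diff_distrib)
    moreover have "real L / (real k * real (n' choose k)) \<in> \<int>" "real L / (real k * real (Suc n' choose k)) \<in> \<int>"
      using False Suc.prems n by (auto intro!: Suc.IH)
    ultimately show ?thesis unfolding n by simp
  qed
qed simp

text \<open>Two bounds for \<open>L\<close>, the least common multiple of 1, ..., \<open>N\<close>:
  each prime contributes a power at most \<open>N\<close>, so \<open>L <= N ^ card P\<close>, while
  \<open>n * (N choose n)\<close> divides \<open>L\<close> by the harmonic triangle and is at least
  \<open>4 ^ n / 2\<close>.\<close>

lemma chebyshev_lower:
  assumes "n \<ge> 1"
  shows "real n * ln 4 - ln 2 \<le> real (card {p. prime p \<and> p \<le> 2 * n}) * ln (2 * real n)"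
proof -
  define N where "N = 2 * n"
  have N0: "N \<ge> 2" using assms by (simp add: N_def)
  define P where "P = {p. prime p \<and> p \<le> N}"
  have fin: "finite P" by (simp add: P_def)
  define e where "e = (\<lambda>p. Max {e. p ^ e \<le> N})"
  have fin_e: "finite {e. p ^ e \<le> N}" if "prime p" for p
  proof (rule finite_subset)
    show "{e. p ^ e \<le> N} \<subseteq> {..N}"
    proof
      fix e assume "e \<in> {e. p ^ e \<le> N}"
      have "e < 2 ^ e" by (rule less_exp)
      also have "2 ^ e \<le> p ^ e" using prime_ge_2_nat[OF that] by (intro power_mono) auto
      finally show "e \<in> {..N}" using \<open>e \<in> _\<close> by simp
    qed
  qed simp
  define L where "L = (\<Prod>p\<in>P. p ^ e p)"
  have L0: "L > 0" unfolding L_def by (intro prod_pos) (auto simp: P_def prime_gt_0_nat)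
  have dvd: "m dvd L" if m: "1 \<le> m" "m \<le> N" for m
  proof -
    have "m = (\<Prod>p\<in>prime_factors m. p ^ multiplicity p m)"
      using m prime_factorization_nat[of m] by simp
    also have "\<dots> dvd L"
      unfolding L_def
    proof (rule prod_dvd_prod_subset2[OF fin])
      show "prime_factors m \<subseteq> P"
        using m by (auto simp: P_def in_prime_factors_iff dest!: dvd_imp_le)
      fix p assume p: "p \<in> prime_factors m"
      then have pr: "prime p" by (simp add: in_prime_factors_iff)
      have "p ^ multiplicity p m \<le> m" using m by (intro dvd_imp_le multiplicity_dvd) auto
      then have "multiplicity p m \<le> e p"
        unfolding e_def using m by (intro Max_ge fin_e[OF pr]) auto
      then show "p ^ multiplicity p m dvd p ^ e p" by (rule le_imp_power_dvd)
    qed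
    finally show ?thesis .
  qed
  have "L \<le> (\<Prod>p\<in>P. N)"
    unfolding L_def
  proof (rule prod_mono)
    fix p assume "p \<in> P"
    then have pr: "prime p" by (simp add: P_def)
    have "e p \<in> {e. p ^ e \<le> N}"
      unfolding e_def using N0 by (intro Max_in fin_e[OF pr]) (auto intro: exI[of _ 0])
    then show "0 \<le> p ^ e p \<and> p ^ e p \<le> N" by simp
  qed
  then have "L \<le> N ^ card P" by simp
  then have "real L \<le> real N ^ card P" by (metis of_nat_le_iff of_nat_power)
  moreover have "4 ^ n / 2 \<le> real L"
  proof -
    define c where "c = real n * real (N choose n)"
    have "4 ^ n / (2 * real n) \<le> real (N choose n)"
      unfolding N_def using assms central_binomial_lower_bound[of n] by simp
    then have c: "4 ^ n / 2 \<le> c" using assms by (simp add: c_def field_simps)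
    moreover have "0 < 4 ^ n / (2::real)" by simp
    ultimately have c0: "c > 0" by linarith
    have "real L / c \<in> \<int>"
      unfolding c_def using assms by (intro mult_binomial_dvd_common_multiple[where N = N] dvd) (auto simp: N_def)
    then obtain i where i: "real L / c = of_int i" by (auto elim: Ints_cases)
    moreover have "real L / c > 0" using c0 L0 by simp
    ultimately have "i \<ge> 1" by simp
    then have "real L / c \<ge> 1" using i by simp
    then have "real L \<ge> c" using c0 by (simp add: field_simps)
    with c show ?thesis by linarith
  qed
  ultimately have "4 ^ n / 2 \<le> real N ^ card P" by linarith
  then have "ln (4 ^ n / 2) \<le> ln (real N ^ card P)" using N0 by simp
  also have "ln (real N ^ card P) = real (card P) * ln (real N)" using N0 by (simp add: ln_realpow)
  finally show ?thesis by (simp add: ln_div ln_realpow N_def P_def)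
qed

text \<open>Giving up a factor of order \<open>ln y\<close> against Chebyshev absorbs every
  constant; the remaining factor 2 pays for deleting the primes up to \<open>y / ln y ^ 2\<close> in
  \<open>card_primes_interval_ge\<close>.\<close>

lemma card_primes_ge:
  "\<forall>\<^sub>F y::real in at_top. 2 * y / ln y ^ 2 \<le> real (card {p. prime p \<and> real p \<le> y})"
proof -
  have "\<forall>\<^sub>F y::real in at_top. 2 * y / ln y ^ 2 * ln y \<le> (y / 2 - 1) * ln 4 - ln 2"
    by real_asymp
  then show ?thesis using eventually_ge_at_top[of 4]
  proof eventually_elim
    case (elim y)
    define n where "n = nat \<lfloor>y / 2\<rfloor>"
    have n: "n \<ge> 1" "real n \<le> y / 2" "y / 2 - 1 \<le> real n" unfolding n_def using elim(2) by linarith+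
    define P where "P = {p. prime p \<and> real p \<le> y}"
    have "P \<subseteq> {..nat \<lfloor>y\<rfloor>}" by (auto simp: P_def le_nat_floor)
    then have fin: "finite P" using finite_subset by blast
    have ly: "ln y > 0" using elim by simp
    have "2 * y / ln y ^ 2 * ln y \<le> (y / 2 - 1) * ln 4 - ln 2" by (rule elim)
    also have "\<dots> \<le> real n * ln 4 - ln 2" using n by simp
    also have "\<dots> \<le> real (card {p. prime p \<and> p \<le> 2 * n}) * ln (2 * real n)"
      by (rule chebyshev_lower[OF n(1)])
    also have "\<dots> \<le> real (card P) * ln y"
    proof (intro mult_mono)
      have "{p. prime p \<and> p \<le> 2 * n} \<subseteq> P" using n by (auto simp: P_def)
      then show "real (card {p. prime p \<and> p \<le> 2 * n}) \<le> real (card P)"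
        using fin by (simp add: card_mono)
    qed (use n in auto)
    finally show ?case using ly unfolding P_def by (simp add: field_simps)
  qed
qed

lemma card_primes_interval_ge:
  "\<forall>\<^sub>F y::real in at_top. y / ln y ^ 2 \<le> real (card {p. prime p \<and> y / ln y ^ 2 < real p \<and> real p \<le> y})"
  using card_primes_ge eventually_ge_at_top[of 4]
proof eventually_elim
  case (elim y)
  define w where "w = y / ln y ^ 2"
  have w0: "w \<ge> 0" using elim by (simp add: w_def)
  let ?P = "{p. prime p \<and> real p \<le> y}" and ?Q = "{p. prime p \<and> w < real p \<and> real p \<le> y}"
  have "?P \<subseteq> {1..nat \<lfloor>w\<rfloor>} \<union> ?Q"
  proof
    fix p assume "p \<in> ?P"
    then show "p \<in> {1..nat \<lfloor>w\<rfloor>} \<union> ?Q"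
      using prime_ge_1_nat[of p] by (cases "real p \<le> w") (auto simp: le_nat_floor)
  qed
  moreover have "?Q \<subseteq> {..nat \<lfloor>y\<rfloor>}" by (auto simp: le_nat_floor)
  then have "finite ?Q" using finite_subset by blast
  ultimately have "card ?P \<le> card ({1..nat \<lfloor>w\<rfloor>} \<union> ?Q)" by (intro card_mono) auto
  also have "\<dots> \<le> nat \<lfloor>w\<rfloor> + card ?Q" using card_Un_le[of "{1..nat \<lfloor>w\<rfloor>}" ?Q] by simp
  finally have "real (card ?P) \<le> w + real (card ?Q)" using w0 by linarith
  moreover have "2 * w \<le> real (card ?P)" using elim by (simp add: w_def)
  ultimately show ?case unfolding w_def by linarith
qed

section \<open>Ordered factorizations\<close>

fun tau :: "nat \<Rightarrow> nat \<Rightarrow> nat" where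
  "tau 0 v = (if v = 1 then 1 else 0)"
| "tau (Suc k) v = (\<Sum>d | d dvd v. tau k (v div d))"

text \<open>Each divisor of \<open>b * c\<close> is some \<open>d * e\<close> with
  \<open>d dvd b\<close> and \<open>e dvd c\<close>; repeated products only increase the right-hand
  side.\<close>

lemma tau_submult:
  assumes "b > 0" "c > 0"
  shows "tau k (b * c) \<le> tau k b * tau k c"
  using assms
proof (induction k arbitrary: b c)
  case (Suc k)
  let ?I = "{d. d dvd b} \<times> {d. d dvd c}"
  have sub: "{d. d dvd b * c} \<subseteq> (\<lambda>(d, e). d * e) ` ?I"
    by (auto dest: division_decomp)
  have "tau (Suc k) (b * c) \<le> (\<Sum>d\<in>(\<lambda>(d, e). d * e) ` ?I. tau k (b * c div d))"
    using sub Suc.prems by (simp del: mult_cancel_left) (intro sum_mono2, auto)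
  also have "\<dots> \<le> sum ((\<lambda>d. tau k (b * c div d)) \<circ> (\<lambda>(d, e). d * e)) ?I"
    using Suc.prems by (intro sum_image_le) auto
  also have "\<dots> = (\<Sum>(d, e)\<in>?I. tau k (b * c div (d * e)))"
    by (simp add: case_prod_unfold o_def)
  also have "\<dots> \<le> (\<Sum>(d, e)\<in>?I. tau k (b div d) * tau k (c div e))"
  proof (intro sum_mono, safe)
    fix d e assume "d dvd b" "e dvd c"
    then have "b * c div (d * e) = (b div d) * (c div e)" by (simp add: div_mult_div_if_dvd)
    moreover have "b div d > 0" "c div e > 0"
      using \<open>d dvd b\<close> \<open>e dvd c\<close> Suc.prems by (auto simp: dvd_div_eq_0_iff intro!: Nat.gr0I)
    ultimately show "tau k (b * c div (d * e)) \<le> tau k (b div d) * tau k (c div e)"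
      using Suc.IH by simp
  qed
  also have "\<dots> = tau (Suc k) b * tau (Suc k) c"
    by (simp add: sum_product sum.cartesian_product)
  finally show ?case .
qed auto

lemma sum_divisors_swap:
  fixes F :: "nat \<Rightarrow> nat \<Rightarrow> real"
  shows "(\<Sum>v=1..N. \<Sum>d | d dvd v. F d (v div d)) = (\<Sum>d=1..N. \<Sum>u=1..N div d. F d u)"
proof -
  have "(\<Sum>v=1..N. \<Sum>d | d dvd v. F d (v div d)) = (\<Sum>(v, d)\<in>Sigma {1..N} (\<lambda>v. {d. d dvd v}). F d (v div d))"
    by (rule sum.Sigma) auto
  also have "\<dots> = (\<Sum>(d, u)\<in>Sigma {1..N} (\<lambda>d. {1..N div d}). F d u)"
  proof (rule sum.reindex_bij_witness[of _ "\<lambda>(d, u). (d * u, d)" "\<lambda>(v, d). (d, v div d)"])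
    fix a assume a: "a \<in> Sigma {1..N} (\<lambda>v. {d. d dvd v})"
    then obtain v d where vd: "a = (v, d)" "1 \<le> v" "v \<le> N" "d dvd v" by auto
    then have "d > 0" "d \<le> v" by (auto intro: dvd_imp_le Nat.gr0I)
    then show "(case a of (v, d) \<Rightarrow> (d, v div d)) \<in> Sigma {1..N} (\<lambda>d. {1..N div d})"
      using vd by (auto simp: div_le_mono Suc_le_eq div_greater_zero_iff)
  next
    fix b assume b: "b \<in> Sigma {1..N} (\<lambda>d. {1..N div d})"
    then obtain d u where du: "b = (d, u)" "1 \<le> d" "d \<le> N" "1 \<le> u" "u \<le> N div d" by auto
    then have "d * u \<le> N" by (simp add: less_eq_div_iff_mult_less_eq mult.commute)
    then show "(case b of (d, u) \<Rightarrow> (d * u, d)) \<in> Sigma {1..N} (\<lambda>v. {d. d dvd v})"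
      using du by auto
  qed auto
  also have "\<dots> = (\<Sum>d=1..N. \<Sum>u=1..N div d. F d u)"
    by (rule sum.Sigma[symmetric]) auto
  finally show ?thesis .
qed

lemma harmonic_le: "N \<ge> 1 \<Longrightarrow> (\<Sum>d=1..N. 1 / real d) \<le> 1 + ln (real N)"
proof -
  assume "N \<ge> 1"
  then obtain n where n: "N = Suc n" by (cases N) auto
  have "harm (Suc n) - ln (real (Suc n)) \<le> harm (Suc 0) - ln (real (Suc 0))"
    using decseqD[OF decseq_harm_diff_ln, of 0 n] by simp
  then show ?thesis by (simp add: n harm_def inverse_eq_divide)
qed

text \<open>The bound uses a fixed \<open>x >= N\<close>, so that the induction hypothesis at
  \<open>N div d\<close> yields the same logarithm; each of the \<open>k\<close> factors then costs
  one harmonic sum.\<close>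

lemma sum_tau_div_le:
  assumes "1 \<le> N" "real N \<le> x"
  shows "(\<Sum>v=1..N. real (tau k v) / real v) \<le> (1 + ln x) ^ k"
  using assms
proof (induction k arbitrary: N)
  case 0
  have "(\<Sum>v=1..N. real (tau 0 v) / real v) = (\<Sum>v=1..N. if v = 1 then 1 else 0)"
    by (intro sum.cong) auto
  then show ?case by simp
next
  case (Suc k)
  have lx: "ln (real N) \<le> ln x" "ln x \<ge> 0" using Suc.prems by auto
  have "(\<Sum>v=1..N. real (tau (Suc k) v) / real v)
      = (\<Sum>v=1..N. \<Sum>d | d dvd v. 1 / real d * (real (tau k (v div d)) / real (v div d)))"
  proof (rule sum.cong[OF refl])
    fix v assume v: "v \<in> {1..N}"
    have "real (tau k (v div d)) / real v = 1 / real d * (real (tau k (v div d)) / real (v div d))"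
      if "d dvd v" for d using that v by (auto simp: real_of_nat_div)
    then show "real (tau (Suc k) v) / real v
        = (\<Sum>d | d dvd v. 1 / real d * (real (tau k (v div d)) / real (v div d)))"
      by (simp only: tau.simps of_nat_sum sum_divide_distrib) (intro sum.cong, auto)
  qed
  also have "\<dots> = (\<Sum>d=1..N. \<Sum>u=1..N div d. 1 / real d * (real (tau k u) / real u))"
    by (rule sum_divisors_swap)
  also have "\<dots> = (\<Sum>d=1..N. 1 / real d * (\<Sum>u=1..N div d. real (tau k u) / real u))"
    by (simp add: sum_distrib_left)
  also have "\<dots> \<le> (\<Sum>d=1..N. 1 / real d * (1 + ln x) ^ k)"
  proof (intro sum_mono mult_left_mono Suc.IH)
    fix d assume d: "d \<in> {1..N}"
    then show "1 \<le> N div d" by (simp add: Suc_le_eq div_greater_zero_iff)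
    have "real (N div d) \<le> real N" by (simp only: of_nat_le_iff) simp
    then show "real (N div d) \<le> x" using Suc.prems by linarith
  qed auto
  also have "\<dots> = (\<Sum>d=1..N. 1 / real d) * (1 + ln x) ^ k"
    by (simp add: sum_distrib_right)
  also have "\<dots> \<le> (1 + ln x) * (1 + ln x) ^ k"
    using harmonic_le[OF Suc.prems(1)] lx by (intro mult_right_mono) auto
  finally show ?case by simp
qed

text \<open>Peeling one factor off \<open>tau (Suc k)\<close> and splitting
  \<open>tau j (d * u)\<close> by submultiplicativity leaves the sum of \<open>tau j d / d\<close>,
  which costs \<open>(1 + ln x) ^ j\<close>. Doing this \<open>k\<close> times gives the exponent
  \<open>j * k\<close>.\<close>

lemma sum_tau_mult_le:
  assumes "1 \<le> N" "real N \<le> x"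
  shows "(\<Sum>v=1..N. real (tau j v * tau k v)) \<le> real N * (1 + ln x) ^ (j * k)"
  using assms
proof (induction k arbitrary: N)
  case 0
  have "(\<Sum>v=1..N. real (tau j v * tau 0 v)) = (\<Sum>v=1..N. if v = 1 then real (tau j 1) else 0)"
    by (intro sum.cong) auto
  also have "tau j 1 = 1" by (induction j) auto
  finally show ?case using 0 by simp
next
  case (Suc k)
  have lx: "ln x \<ge> 0" using Suc.prems by auto
  have "(\<Sum>v=1..N. real (tau j v * tau (Suc k) v))
      = (\<Sum>v=1..N. \<Sum>d | d dvd v. real (tau j (d * (v div d)) * tau k (v div d)))"
    by (intro sum.cong) (auto simp: sum_distrib_left)
  also have "\<dots> = (\<Sum>d=1..N. \<Sum>u=1..N div d. real (tau j (d * u) * tau k u))"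
    by (rule sum_divisors_swap)
  also have "\<dots> \<le> (\<Sum>d=1..N. \<Sum>u=1..N div d. real (tau j d) * real (tau j u * tau k u))"
  proof (intro sum_mono)
    fix d u assume "d \<in> {1..N}" "u \<in> {1..N div d}"
    then have "tau j (d * u) \<le> tau j d * tau j u" by (intro tau_submult) auto
    then have "tau j (d * u) * tau k u \<le> tau j d * tau j u * tau k u" by (rule mult_le_mono1)
    then have "real (tau j (d * u) * tau k u) \<le> real (tau j d * tau j u * tau k u)" by (simp only: of_nat_le_iff)
    then show "real (tau j (d * u) * tau k u) \<le> real (tau j d) * real (tau j u * tau k u)"
      by (simp add: mult.assoc)
  qed
  also have "\<dots> = (\<Sum>d=1..N. real (tau j d) * (\<Sum>u=1..N div d. real (tau j u * tau k u)))"
    by (simp add: sum_distrib_left)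
  also have "\<dots> \<le> (\<Sum>d=1..N. real (tau j d) * (real N / real d * (1 + ln x) ^ (j * k)))"
  proof (intro sum_mono mult_left_mono)
    fix d assume d: "d \<in> {1..N}"
    have "real (N div d) \<le> real N" by (simp only: of_nat_le_iff) simp
    then have "real (N div d) \<le> x" using Suc.prems by linarith
    then have "(\<Sum>u=1..N div d. real (tau j u * tau k u)) \<le> real (N div d) * (1 + ln x) ^ (j * k)"
      using d by (intro Suc.IH) (auto simp: Suc_le_eq div_greater_zero_iff)
    also have "\<dots> \<le> real N / real d * (1 + ln x) ^ (j * k)"
      using lx by (intro mult_right_mono of_nat_div_le_of_nat) auto
    finally show "(\<Sum>u=1..N div d. real (tau j u * tau k u)) \<le> real N / real d * (1 + ln x) ^ (j * k)" .
  qed auto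
  also have "\<dots> = real N * (1 + ln x) ^ (j * k) * (\<Sum>d=1..N. real (tau j d) / real d)"
    by (simp add: sum_distrib_left field_simps)
  also have "\<dots> \<le> real N * (1 + ln x) ^ (j * k) * (1 + ln x) ^ j"
    using lx Suc.prems by (intro mult_left_mono sum_tau_div_le) auto
  finally show ?case by (simp add: power_add mult_ac)
qed

text \<open>Splitting off the last component \<open>y\<close> amounts to choosing the divisor
  \<open>d = y + 1\<close> of \<open>v\<close>, which matches the recursion of
  \<open>tau\<close>.\<close>

lemma card_factorizations_le:
  fixes P :: "nat \<Rightarrow> nat set"
  assumes fin: "\<And>i. finite (P i)" and v: "v > 0"
  shows "card {f \<in> PiE {..<J} P. (\<Prod>i<J. f i + 1) = v} \<le> tau J v"
  using v
proof (induction J arbitrary: v)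
  case 0
  then show ?case by auto
next
  case (Suc J)
  let ?F = "PiE {..<J} P"
  have finF: "finite ?F" using fin by (intro finite_PiE) auto
  have "{f \<in> PiE {..<Suc J} P. (\<Prod>i<Suc J. f i + 1) = v}
     \<subseteq> (\<lambda>(y, g). g(J := y)) ` (\<Union>d\<in>{d. d dvd v}. {d - 1} \<times> {g \<in> ?F. (\<Prod>i<J. g i + 1) = v div d})"
  proof
    fix f assume "f \<in> {f \<in> PiE {..<Suc J} P. (\<Prod>i<Suc J. f i + 1) = v}"
    then have f: "f \<in> PiE {..<Suc J} P" and v: "v = (\<Prod>i<Suc J. f i + 1)" by auto
    have "f \<in> PiE (insert J {..<J}) P" using f by (simp add: lessThan_Suc)
    then obtain y g where g: "f = g(J := y)" "y \<in> P J" "g \<in> ?F"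
      unfolding PiE_insert_eq by auto
    have eq: "(\<Prod>i<J. (g(J := y)) i + 1) = (\<Prod>i<J. g i + 1)" by (intro prod.cong) auto
    have "v = (\<Prod>i<J. g i + 1) * (y + 1)" unfolding v g(1) prod.lessThan_Suc eq by simp
    then have "y + 1 dvd v" "v div (y + 1) = (\<Prod>i<J. g i + 1)" by (auto simp del: mult_Suc_right)
    then have "(y, g) \<in> (\<Union>d\<in>{d. d dvd v}. {d - 1} \<times> {g \<in> ?F. (\<Prod>i<J. g i + 1) = v div d})"
      using g by (intro UN_I[of "y + 1"]) auto
    then show "f \<in> (\<lambda>(y, g). g(J := y)) ` (\<Union>d\<in>{d. d dvd v}.
        {d - 1} \<times> {g \<in> ?F. (\<Prod>i<J. g i + 1) = v div d})"
      using g(1) by (intro image_eqI[of _ _ "(y, g)"]) auto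
  qed
  then have "card {f \<in> PiE {..<Suc J} P. (\<Prod>i<Suc J. f i + 1) = v}
     \<le> card ((\<lambda>(y, g). g(J := y)) ` (\<Union>d\<in>{d. d dvd v}. {d - 1} \<times> {g \<in> ?F. (\<Prod>i<J. g i + 1) = v div d}))"
    using finF Suc.prems by (intro card_mono) auto
  also have "\<dots> \<le> card (\<Union>d\<in>{d. d dvd v}. {d - 1} \<times> {g \<in> ?F. (\<Prod>i<J. g i + 1) = v div d})"
    using finF Suc.prems by (intro card_image_le) auto
  also have "\<dots> \<le> (\<Sum>d | d dvd v. card ({d - 1} \<times> {g \<in> ?F. (\<Prod>i<J. g i + 1) = v div d}))"
    using Suc.prems by (intro card_UN_le) auto
  also have "\<dots> = (\<Sum>d | d dvd v. card {g \<in> ?F. (\<Prod>i<J. g i + 1) = v div d})"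
    by (simp add: card_cartesian_product)
  also have "\<dots> \<le> (\<Sum>d | d dvd v. tau J (v div d))"
    using Suc.prems by (intro sum_mono Suc.IH) (auto simp: dvd_div_eq_0_iff intro!: Nat.gr0I)
  finally show ?case by simp
qed

lemma card_products_ge:
  fixes P :: "nat \<Rightarrow> nat set" and J :: nat
  defines "F \<equiv> PiE {..<J} P"
  assumes fin: "\<And>i. finite (P i)" and Z: "Z \<ge> 1" "\<And>f. f \<in> F \<Longrightarrow> (\<Prod>i<J. f i + 1) \<le> Z" "real Z \<le> x"
  shows "real (card F) ^ 2 \<le> real (card ((\<lambda>f. \<Prod>i<J. f i + 1) ` F)) * (real Z * (1 + ln x) ^ (J * J))"
proof -
  define \<phi> where "\<phi> = (\<lambda>f::nat \<Rightarrow> nat. \<Prod>i<J. f i + 1)"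
  have finF: "finite F" unfolding F_def using fin by (intro finite_PiE) auto
  define r where "r = (\<lambda>u. card {f\<in>F. \<phi> f = u})"
  have "card F = (\<Sum>u\<in>\<phi> ` F. r u)"
    unfolding r_def using sum.group[of F "\<phi> ` F" \<phi> "\<lambda>_. 1::nat"] finF by simp
  then have "real (card F) ^ 2 = (\<Sum>u\<in>\<phi> ` F. real (r u)) ^ 2" by simp
  also have "\<dots> \<le> (\<Sum>u\<in>\<phi> ` F. real (r u) ^ 2) * real (card (\<phi> ` F))"
    using finF Cauchy_Schwarz_ineq_sum[of "\<lambda>u. real (r u)" "\<lambda>_. 1" "\<phi> ` F"] by simp
  also have "(\<Sum>u\<in>\<phi> ` F. real (r u) ^ 2) \<le> (\<Sum>u=1..Z. real (tau J u * tau J u))"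
  proof -
    have sub: "\<phi> ` F \<subseteq> {1..Z}" using Z(2) by (auto simp: \<phi>_def Suc_le_eq intro!: prod_pos)
    have "(\<Sum>u\<in>\<phi> ` F. real (r u) ^ 2) \<le> (\<Sum>u\<in>\<phi> ` F. real (tau J u * tau J u))"
    proof (rule sum_mono)
      fix u assume "u \<in> \<phi> ` F"
      then have "u > 0" using sub by auto
      then have "r u \<le> tau J u"
        unfolding r_def \<phi>_def F_def by (intro card_factorizations_le fin)
      then show "real (r u) ^ 2 \<le> real (tau J u * tau J u)"
        by (simp add: power2_eq_square mult_mono)
    qed
    also have "\<dots> \<le> (\<Sum>u=1..Z. real (tau J u * tau J u))" using sub by (intro sum_mono2) auto
    finally show ?thesis .
  qed
  also have "\<dots> \<le> real Z * (1 + ln x) ^ (J * J)" using Z by (intro sum_tau_mult_le)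
  finally show ?thesis unfolding \<phi>_def by (simp add: mult.commute mult_right_mono)
qed

section \<open>The lower bound\<close>

text \<open>The lower end keeps \<open>p\<close> within a factor \<open>ln y ^ 2\<close> of
  \<open>y\<close>, a loss small enough to be repaired by a power of 2, while
  \<open>card_primes_interval_ge\<close> still provides \<open>y / ln y ^ 2\<close> primes for large
  \<open>y\<close>.\<close>

definition prime_window :: "real \<Rightarrow> nat set" where
  "prime_window y = {p. prime p \<and> y / ln y ^ 2 < real p \<and> real p \<le> y}"

lemma finite_prime_window: "finite (prime_window y)"
  by (rule finite_subset[of _ "{..nat \<lfloor>y\<rfloor>}"]) (auto simp: prime_window_def le_nat_floor)

text \<open>The factor \<open>2\<^sup>r\<close> makes up for the loss of at most \<open>T\<close> at each of the \<open>J\<close> scales, which keeps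
  every prime of the next window admissible.\<close>
locale prime_tower =
  fixes B T :: real and J r :: nat
  assumes B1: "B > 1"
    and window: "\<And>y. y \<ge> B \<Longrightarrow> y / ln y ^ 2 \<le> real (card (prime_window y))"
    and gap: "\<And>y. y \<ge> B \<Longrightarrow> 4 * ln y ^ 2 < y"
    and T: "T \<ge> 1" "\<And>j. j < J \<Longrightarrow> ln (B ^ 2 ^ j) ^ 2 \<le> T"
    and r: "B * T ^ J \<le> 2 ^ r"
begin

definition scale :: "nat \<Rightarrow> real" where "scale j = B ^ 2 ^ j"

definition tuples :: "(nat \<Rightarrow> nat) set" where
  "tuples = PiE {..<J} (\<lambda>j. prime_window (scale j))"

lemma scale_ge: "scale j \<ge> B"
  unfolding scale_def using B1 self_le_power[of B "2 ^ j"] by simp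

lemma scale_Suc: "scale (Suc j) = scale j ^ 2"
  by (simp add: scale_def mult.commute flip: power_mult)

lemma scale_mono: "i \<le> j \<Longrightarrow> scale i \<le> scale j"
  unfolding scale_def using B1 by (intro power_increasing) auto

lemma ln_scale_pos: "ln (scale j) > 0"
  using scale_ge[of j] B1 by simp

text \<open>Because \<open>1 + (1 + 2 + ... + 2 ^ (j - 1)) = 2 ^ j\<close>, the earlier scales
  multiply to the next one up to a single factor \<open>B\<close>. That factor is why
  \<open>B\<close> stands beside \<open>T ^ J\<close> in the assumption \<open>r\<close>.\<close>

lemma prod_scale: "B * (\<Prod>l<j. scale l) = scale j"
  by (induction j) (simp_all add: scale_Suc power2_eq_square, simp add: scale_def)

text \<open>Passing from \<open>y\<close> to \<open>y ^ 2\<close> doubles the logarithm, so the next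
  window starts at \<open>y ^ 2 / (4 * ln y ^ 2)\<close>, which exceeds \<open>y\<close> by
  \<open>gap\<close>. In particular the primes of a tuple are distinct.\<close>

lemma window_gap:
  assumes "i < j" "p \<in> prime_window (scale i)" "q \<in> prime_window (scale j)"
  shows "p < q"
proof -
  obtain k where k: "j = Suc k" "i \<le> k" using assms(1) by (cases j) auto
  define y where "y = scale k"
  have y: "y \<ge> B" "ln y > 0" using scale_ge ln_scale_pos by (auto simp: y_def)
  have y0: "y > 0" using y B1 by simp
  have "real p \<le> y" using assms(2) scale_mono[OF k(2)] by (auto simp: prime_window_def y_def)
  also have "y < y ^ 2 / (4 * ln y ^ 2)"
    using gap[OF y(1)] y y0 by (simp add: field_simps power2_eq_square)
  also have "\<dots> = scale j / ln (scale j) ^ 2"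
    using y0 by (simp add: k scale_Suc y_def[symmetric] ln_realpow power_mult_distrib)
  also have "\<dots> < real q" using assms(3) by (simp add: prime_window_def)
  finally show ?thesis by simp
qed

lemma window_gt_2:
  assumes "p \<in> prime_window (scale j)"
  shows "p > 2"
proof -
  define y where "y = scale j"
  have y: "y \<ge> B" "ln y > 0" using scale_ge ln_scale_pos by (auto simp: y_def)
  have "4 < y / ln y ^ 2" using gap[OF y(1)] y by (simp add: field_simps)
  also have "\<dots> < real p" using assms by (simp add: prime_window_def y_def)
  finally show ?thesis by simp
qed

lemma window_scale_le:
  assumes "p \<in> prime_window (scale j)" "j < J"
  shows "scale j \<le> T * real p"
proof -
  have "scale j < ln (scale j) ^ 2 * real p"
    using assms ln_scale_pos[of j] by (simp add: prime_window_def field_simps)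
  also have "\<dots> \<le> T * real p" using T(2)[OF assms(2)] by (intro mult_right_mono) (auto simp: scale_def)
  finally show ?thesis by simp
qed

lemma tuplesD: "f \<in> tuples \<Longrightarrow> j < J \<Longrightarrow> f j \<in> prime_window (scale j)"
  unfolding tuples_def by (auto simp: PiE_iff)

lemma tuple_chain:
  assumes f: "f \<in> tuples" and "j \<le> J"
  shows "chain_practical (2 ^ r * (\<Prod>l<j. f l))
    \<and> divsum (2 ^ r * (\<Prod>l<j. f l)) = divsum (2 ^ r) * (\<Prod>l<j. f l + 1)"
  using \<open>j \<le> J\<close>
proof (induction j)
  case 0
  have "chain_practical (2 ^ r)"
  proof (cases "r = 0")
    case False
    have "chain_practical (1 * 2 ^ r)"
      using False by (intro chain_practical.step chain_practical.one) auto
    then show ?thesis by simp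
  qed (use chain_practical.one in simp)
  then show ?case by simp
next
  case (Suc j)
  define n where "n = 2 ^ r * (\<Prod>l<j. f l)"
  have n: "chain_practical n" "divsum n = divsum (2 ^ r) * (\<Prod>l<j. f l + 1)"
    using Suc by (auto simp: n_def)
  have n0: "n > 0" using n chain_practical_pos by blast
  have fj: "f j \<in> prime_window (scale j)" using tuplesD[OF f] Suc.prems by simp
  have p: "prime (f j)" using fj by (simp add: prime_window_def)
  have notdvd: "\<not> f j dvd n"
  proof
    assume "f j dvd n"
    then have "f j dvd 2 ^ r \<or> f j dvd (\<Prod>l<j. f l)" using p by (simp add: n_def prime_dvd_mult_iff)
    then show False
    proof
      assume "f j dvd 2 ^ r"
      then have "f j dvd 2" using p prime_dvd_power by blast
      then show False using window_gt_2[OF fj] dvd_imp_le[of "f j" 2] by simp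
    next
      assume "f j dvd (\<Prod>l<j. f l)"
      then obtain l where l: "l < j" "f j dvd f l" using p by (auto simp: prime_dvd_prod_iff)
      have fl: "f l \<in> prime_window (scale l)" using tuplesD[OF f] Suc.prems l by simp
      then have "f j \<le> f l" using l by (intro dvd_imp_le) (auto simp: prime_window_def prime_gt_0_nat)
      then show False using window_gap[OF l(1) fl fj] by simp
    qed
  qed
  \<comment> \<open>Each earlier \<open>f l\<close> falls short of its scale by a factor of at most
    \<open>T\<close>, so \<open>f j <= scale j\<close> is at most \<open>B * T ^ J\<close> times the
    earlier primes, and \<open>2 ^ r\<close> covers that loss: even \<open>f j <= n\<close>
    holds.\<close>
  have "f j \<le> divsum n + 1"
  proof -
    have "real (f j) \<le> scale j" using fj by (simp add: prime_window_def)
    also have "\<dots> = B * (\<Prod>l<j. scale l)" by (simp add: prod_scale)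
    also have "\<dots> \<le> B * (\<Prod>l<j. T * real (f l))"
      using B1 window_scale_le tuplesD[OF f] Suc.prems scale_ge
      by (intro mult_left_mono prod_mono) (auto intro: order_trans[of _ B])
    also have "\<dots> = B * T ^ j * (\<Prod>l<j. real (f l))" by (simp add: prod.distrib)
    also have "\<dots> \<le> B * T ^ J * (\<Prod>l<j. real (f l))"
      using B1 T Suc.prems by (intro mult_right_mono mult_left_mono power_increasing prod_nonneg) auto
    also have "\<dots> \<le> 2 ^ r * (\<Prod>l<j. real (f l))"
      using r by (intro mult_right_mono prod_nonneg) auto
    also have "\<dots> = real n" by (simp add: n_def)
    finally have "f j \<le> n" by simp
    then show ?thesis using divsum_ge[OF n0] by simp
  qed
  then have "chain_practical (n * f j ^ 1)" using n p notdvd by (intro chain_practical.step) auto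
  moreover have "coprime n (f j)" using p notdvd by (metis coprime_commute prime_imp_coprime)
  then have "divsum (n * f j) = divsum n * (f j + 1)"
    using p by (simp add: divsum_coprime_mult divsum_prime)
  moreover have "2 ^ r * (\<Prod>l<Suc j. f l) = n * f j" by (simp add: n_def mult_ac)
  moreover have "(\<Prod>l<Suc j. f l + 1) = (\<Prod>l<j. f l + 1) * (f j + 1)" by (rule prod.lessThan_Suc)
  ultimately show ?case using n(2) by (simp only: power_one_right mult.assoc)
qed

text \<open>Each window has at least \<open>scale l / T\<close> elements, so the count loses the
  same \<open>B * T ^ J\<close> that \<open>2 ^ r\<close> dominates.\<close>

lemma card_tuples: "scale J / 2 ^ r \<le> real (card tuples)"
proof -
  have "scale J / 2 ^ r \<le> scale J / (B * T ^ J)"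
    using r B1 T scale_ge[of J] by (intro divide_left_mono) auto
  also have "\<dots> = (\<Prod>l<J. scale l) / T ^ J"
    using B1 by (simp flip: prod_scale[of J])
  also have "\<dots> = (\<Prod>l<J. scale l / T)" by (simp add: prod_dividef)
  also have "\<dots> \<le> (\<Prod>l<J. real (card (prime_window (scale l))))"
  proof (rule prod_mono, safe)
    fix l assume l: "l < J"
    have s0: "scale l > 0" using scale_ge[of l] B1 by simp
    then show "0 \<le> scale l / T" using T by simp
    have "scale l / T \<le> scale l / ln (scale l) ^ 2"
      using T(2)[OF l] ln_scale_pos[of l] s0 T(1) by (intro divide_left_mono) (auto simp: scale_def)
    also have "\<dots> \<le> real (card (prime_window (scale l)))" by (rule window[OF scale_ge])
    finally show "scale l / T \<le> real (card (prime_window (scale l)))" .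
  qed
  also have "\<dots> = real (card tuples)" by (simp add: tuples_def card_PiE)
  finally show ?thesis .
qed

lemma tuple_prod_le:
  assumes "f \<in> tuples"
  shows "real (\<Prod>i<J. f i + 1) \<le> 2 ^ J * scale J"
proof -
  have "real (\<Prod>i<J. f i + 1) = (\<Prod>i<J. real (f i + 1))" by simp
  also have "\<dots> \<le> (\<Prod>i<J. 2 * scale i)"
  proof (rule prod_mono, safe)
    fix i assume "i < J"
    then have "f i \<in> prime_window (scale i)" using tuplesD[OF assms] by simp
    moreover from this have "f i > 2" by (rule window_gt_2)
    ultimately show "real (f i + 1) \<le> 2 * scale i" by (simp add: prime_window_def)
  qed simp
  also have "\<dots> = 2 ^ J * (\<Prod>i<J. scale i)" by (simp add: prod.distrib)
  also have "\<dots> \<le> 2 ^ J * (B * (\<Prod>i<J. scale i))"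
  proof (intro mult_left_mono)
    have "0 \<le> (\<Prod>i<J. scale i)"
      using scale_ge B1 by (intro prod_nonneg) (auto intro: order_trans[of _ B])
    then show "(\<Prod>i<J. scale i) \<le> B * (\<Prod>i<J. scale i)" using B1 by (simp add: mult_le_cancel_right1)
  qed simp
  finally show ?thesis by (simp only: prod_scale)
qed

text \<open>The endpoints are the products times one fixed \<open>c = divsum (2 ^ r)\<close>, so
  distinct products stay distinct. In \<open>card_products_ge\<close> one factor
  \<open>scale J\<close> cancels, and squaring the tuple count leaves \<open>4 ^ r\<close>.\<close>

lemma card_endpoints_ge:
  assumes x: "2 ^ (r + 1 + J) * scale J \<le> x"
  shows "scale J / (4 ^ r * 2 ^ J * (1 + ln x) ^ (J * J))
    \<le> real (card {m::nat. additive_endpoint m \<and> 1 \<le> m \<and> real m \<le> x})"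
proof -
  let ?E = "{m::nat. additive_endpoint m \<and> 1 \<le> m \<and> real m \<le> x}"
  define \<phi> where "\<phi> = (\<lambda>f::nat \<Rightarrow> nat. \<Prod>i<J. f i + 1)"
  have sJ: "scale J > 1" using scale_ge[of J] B1 by simp
  define Z where "Z = nat \<lfloor>2 ^ J * scale J\<rfloor>"
  have "1 * 1 \<le> 2 ^ J * scale J" using sJ by (intro mult_mono) auto
  then have Z: "Z \<ge> 1" "real Z \<le> 2 ^ J * scale J" unfolding Z_def by linarith+
  have "2 ^ J * scale J \<le> 2 ^ (r + 1 + J) * scale J" using sJ by (intro mult_right_mono power_increasing) auto
  with Z x have Zx: "real Z \<le> x" by linarith
  have "1 \<le> real Z" using Z by simp
  with Zx have x1: "x \<ge> 1" by linarith
  have finE: "finite ?E"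
    by (rule finite_subset[of _ "{..nat \<lfloor>x\<rfloor>}"]) (auto simp: le_nat_floor)
  define c where "c = divsum (2 ^ r)"
  have c0: "c > 0" unfolding c_def by (intro divsum_pos) simp
  have c2: "real c \<le> 2 ^ (r + 1)"
  proof -
    have "c = (\<Sum>i<Suc r. 2 ^ i)" unfolding c_def by (simp add: divsum_prime_power lessThan_Suc_atMost)
    also have "\<dots> = 2 ^ Suc r - 1" by (metis sum_power2 atLeast0LessThan)
    finally have "c \<le> 2 ^ Suc r" by simp
    then have "real c \<le> real (2 ^ Suc r)" by (simp only: of_nat_le_iff)
    then show ?thesis by simp
  qed
  have "(\<lambda>u. c * u) ` (\<phi> ` tuples) \<subseteq> ?E"
  proof safe
    fix f assume f: "f \<in> tuples"
    have v: "chain_practical (2 ^ r * (\<Prod>l<J. f l))" "divsum (2 ^ r * (\<Prod>l<J. f l)) = c * \<phi> f"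
      using tuple_chain[OF f, of J] by (auto simp: c_def \<phi>_def)
    then show "additive_endpoint (c * \<phi> f)" unfolding additive_endpoint_iff by metis
    have "\<phi> f > 0" by (auto simp: \<phi>_def intro!: prod_pos)
    then show "1 \<le> c * \<phi> f" using c0 by (simp add: Suc_le_eq)
    have "real (c * \<phi> f) = real c * real (\<phi> f)" by simp
    also have "\<dots> \<le> 2 ^ (r + 1) * (2 ^ J * scale J)"
    proof (intro mult_mono c2)
      show "real (\<phi> f) \<le> 2 ^ J * scale J" unfolding \<phi>_def by (rule tuple_prod_le[OF f])
    qed auto
    also have "\<dots> \<le> x" using x by (simp add: power_add mult_ac)
    finally show "real (c * \<phi> f) \<le> x" .
  qed
  then have "card ((\<lambda>u. c * u) ` (\<phi> ` tuples)) \<le> card ?E" using finE by (intro card_mono)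
  moreover have "card ((\<lambda>u. c * u) ` (\<phi> ` tuples)) = card (\<phi> ` tuples)"
    using c0 by (intro card_image) (auto simp: inj_on_def)
  ultimately have U: "real (card (\<phi> ` tuples)) \<le> real (card ?E)" by simp
  define H where "H = (1 + ln x) ^ (J * J)"
  have H: "H > 0" using x1 by (simp add: H_def add_pos_nonneg)
  have "(scale J / 2 ^ r) ^ 2 \<le> real (card tuples) ^ 2"
    using card_tuples sJ by (intro power_mono) auto
  also have "\<dots> \<le> real (card (\<phi> ` tuples)) * (real Z * H)"
    unfolding \<phi>_def H_def tuples_def
  proof (rule card_products_ge)
    fix f assume "f \<in> PiE {..<J} (\<lambda>j. prime_window (scale j))"
    then have "f \<in> tuples" by (simp add: tuples_def)
    from tuple_prod_le[OF this] show "(\<Prod>i<J. f i + 1) \<le> Z" unfolding Z_def by (rule le_nat_floor)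
  qed (use Z Zx finite_prime_window in auto)
  also have "\<dots> \<le> real (card ?E) * (2 ^ J * scale J * H)"
    using U Z H by (intro mult_mono) auto
  finally have "scale J * scale J / 4 ^ r \<le> real (card ?E) * (2 ^ J * H) * scale J"
    by (simp add: power_divide power2_eq_square power_mult_distrib[symmetric] mult_ac)
  then have "scale J / 4 ^ r \<le> real (card ?E) * (2 ^ J * H)"
    using sJ by (simp add: field_simps)
  then show ?thesis using H unfolding H_def[symmetric] by (simp add: field_simps)
qed

end

text \<open>To avoid circularity, \<open>J\<close>, \<open>T\<close> and \<open>r\<close> are fixed
  from \<open>x\<close> and the constant \<open>b\<close> alone; only then is \<open>B\<close>
  chosen, as the root that makes \<open>scale J\<close> exactly \<open>x / 2 ^ (r + 1 + J)\<close>.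
  The dominant loss is \<open>(1 + ln x) ^ (J * J)\<close> with \<open>J <= 2 * ln (ln x)\<close>,
  at most about \<open>exp (4 * ln (ln x) ^ 3)\<close>; the constant 5 absorbs the rest.\<close>

theorem additive_endpoints_lower:
  "\<forall>\<^sub>F x::real in at_top. real (card {m::nat. additive_endpoint m \<and> 1 \<le> m \<and> real m \<le> x})
                > x / exp (5 * ln (ln x) ^ 3)"
proof -
  have "\<forall>\<^sub>F y::real in at_top. y / ln y ^ 2 \<le> real (card (prime_window y))"
    using card_primes_interval_ge unfolding prime_window_def .
  moreover have "\<forall>\<^sub>F y::real in at_top. 4 * ln y ^ 2 < y" by real_asymp
  ultimately have "\<forall>\<^sub>F y::real in at_top. y / ln y ^ 2 \<le> real (card (prime_window y)) \<and> 4 * ln y ^ 2 < y"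
    by eventually_elim simp
  then obtain B0 where B0: "\<And>y. y \<ge> B0 \<Longrightarrow> y / ln y ^ 2 \<le> real (card (prime_window y)) \<and> 4 * ln y ^ 2 < y"
    by (auto simp: eventually_at_top_linorder)
  define b where "b = max 1 (ln (max 1 B0))"
  have b: "b \<ge> 1" by (simp add: b_def)
  have bB: "exp b \<ge> B0"
  proof -
    have "ln (max 1 B0) \<le> b" unfolding b_def by (rule max.cobounded2)
    then have "exp (ln (max 1 B0)) \<le> exp b" by (simp only: exp_le_cancel_iff)
    moreover have "exp (ln (max 1 B0)) = max 1 B0" by (rule exp_ln) simp
    moreover have "B0 \<le> max 1 B0" by simp
    ultimately show ?thesis by linarith
  qed
  have main: "x / exp (5 * ln (ln x) ^ 3) < real (card {m::nat. additive_endpoint m \<and> 1 \<le> m \<and> real m \<le> x})"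
    if x: "x \<ge> 3" and L: "ln (ln x) \<ge> 1"
      and Jpos: "4 * b \<le> ln x"
      and big1: "(4 * b + 2 * (2 * ln (ln x)) * ln (ln x)) / ln 2 + 2 + 2 * ln (ln x) \<le> ln x / 2"
      and big2: "3 * ((4 * b + 2 * (2 * ln (ln x)) * ln (ln x)) / ln 2 + 1) + 4 * ln (ln x) + 1
          + (2 * ln (ln x)) ^ 2 * ln (1 + ln x) < 5 * ln (ln x) ^ 3" for x :: real
  proof -
    define L where "L = ln (ln x)"
    have lx: "ln x > 1" using x ln3_gt_1 ln_le_cancel_iff[of 3 x] by linarith
    have L1: "L \<ge> 1" using L by (simp add: L_def)
    have eL: "exp L = ln x" using lx by (simp add: L_def)
    \<comment> \<open>Makes \<open>2 ^ J\<close> agree with \<open>ln x / (2 * b)\<close> up to a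
      factor 2, which confines \<open>ln B\<close> to the interval from \<open>b\<close> to
      \<open>4 * b\<close>.\<close>
    define J where "J = nat \<lfloor>log 2 (ln x / (2 * b))\<rfloor>"
    have lg: "log 2 (ln x / (2 * b)) \<ge> 1"
      using Jpos b by (subst le_log_iff) (auto simp: field_simps)
    have J1: "real J \<le> log 2 (ln x / (2 * b))" "log 2 (ln x / (2 * b)) \<le> real J + 1"
      unfolding J_def using lg by linarith+
    have pJ: "(2::real) ^ J \<le> ln x / (2 * b)" "ln x / (2 * b) \<le> 2 * 2 ^ J"
    proof -
      have q: "ln x / (2 * b) > 0" using lx b by simp
      have "(2::real) powr real J \<le> 2 powr log 2 (ln x / (2 * b))" using J1 by (intro powr_mono) auto
      then show "(2::real) ^ J \<le> ln x / (2 * b)" using q by (simp add: powr_realpow)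
      have "2 powr log 2 (ln x / (2 * b)) \<le> (2::real) powr (real J + 1)" using J1 by (intro powr_mono) auto
      then show "ln x / (2 * b) \<le> 2 * 2 ^ J" using q by (simp add: powr_add powr_realpow mult.commute)
    qed
    have JL: "real J \<le> L / ln 2"
    proof -
      have "log 2 (ln x / (2 * b)) \<le> log 2 (ln x)" using lx b by (simp add: divide_le_eq)
      then show ?thesis using J1 by (simp add: log_def L_def)
    qed
    have ln2: "ln 2 \<ge> (1/2::real)"
      using ln_le_minus_one[of "1/2 :: real"] by (simp add: ln_div)
    have JL2: "real J \<le> 2 * L"
    proof -
      have "L / ln 2 \<le> L / (1/2)" using ln2 L1 by (intro divide_left_mono) auto
      then show ?thesis using JL by simp
    qed
    define T where "T = ln x ^ 2"
    have T1: "T \<ge> 1" using lx by (simp add: T_def)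
    \<comment> \<open>\<open>2 powr R\<close> equals \<open>exp (4 * b) * T ^ J\<close>, the bound
      for \<open>B * T ^ J\<close> available before \<open>B\<close> is chosen.\<close>
    define R where "R = (4 * b + 2 * real J * L) / ln 2"
    define r where "r = nat \<lceil>R\<rceil>"
    have R0: "R \<ge> 0" using b L1 by (simp add: R_def)
    have r1: "R \<le> real r" "real r \<le> R + 1" unfolding r_def using R0 by linarith+
    have RL: "R \<le> (4 * b + 2 * (2 * L) * L) / ln 2"
      unfolding R_def using JL2 L1 by (intro divide_right_mono add_left_mono mult_right_mono mult_left_mono) auto
    have r2: "exp (4 * b) * T ^ J \<le> 2 ^ r"
    proof -
      have "exp (4 * b) * T ^ J = exp (4 * b + 2 * real J * L)"
        unfolding T_def eL[symmetric] by (simp add: exp_add exp_of_nat_mult[symmetric] power_mult[symmetric] mult_ac)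
      also have "\<dots> = 2 powr R" by (simp add: R_def powr_def)
      also have "\<dots> \<le> 2 powr real r" using r1 by (intro powr_mono) auto
      finally show ?thesis by (simp add: powr_realpow)
    qed
    define X where "X = x / 2 ^ (r + 1 + J)"
    have X0: "X > 0" using x by (simp add: X_def)
    have lnX: "ln X = ln x - real (r + 1 + J) * ln 2"
    proof -
      have "ln ((2::real) ^ (r + 1 + J)) = real (r + 1 + J) * ln 2" by (rule ln_realpow)
      moreover have "ln X = ln x - ln ((2::real) ^ (r + 1 + J))"
        unfolding X_def using x by (subst ln_divide_pos) (auto simp del: power_add)
      ultimately show ?thesis by linarith
    qed
    have "real (r + 1 + J) * ln 2 \<le> ln x / 2"
    proof -
      have "ln 2 \<le> (1::real)" using ln_le_minus_one[of 2] by simp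
      then have "real (r + 1 + J) * ln 2 \<le> real (r + 1 + J) * 1" by (intro mult_left_mono) auto
      also have "\<dots> \<le> R + 2 + 2 * L" using r1 JL2 by simp
      also have "\<dots> \<le> ln x / 2" using RL big1 unfolding L_def by linarith
      finally show ?thesis .
    qed
    then have lX: "ln x / 2 \<le> ln X" "ln X \<le> ln x" unfolding lnX by auto
    define B where "B = exp (ln X / 2 ^ J)"
    have BX: "B ^ 2 ^ J = X" using X0 by (simp add: B_def flip: exp_of_nat_mult)
    have lnB: "b \<le> ln B" "ln B \<le> 4 * b"
    proof -
      have "b * 2 ^ J \<le> b * (ln x / (2 * b))" using pJ(1) b by (intro mult_left_mono) auto
      also have "\<dots> = ln x / 2" using b by simp
      also have "\<dots> \<le> ln X" by (rule lX)
      finally show "b \<le> ln B" by (simp add: B_def field_simps)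
      have "ln X \<le> ln x" by (rule lX)
      also have "\<dots> = 2 * b * (ln x / (2 * b))" using b by simp
      also have "\<dots> \<le> 2 * b * (2 * 2 ^ J)" using pJ(2) b by (intro mult_left_mono) auto
      finally show "ln B \<le> 4 * b" by (simp add: B_def field_simps)
    qed
    have Bpos: "B > 0" by (simp add: B_def)
    have B1: "B > 1" using lnB b Bpos by (metis ln_gt_zero_iff less_le_trans zero_less_one)
    have Bb: "exp b \<le> B" using lnB Bpos by (simp add: ln_ge_iff)
    have "2 ^ (r + 1 + J) * (4 ^ r * 2 ^ J * (1 + ln x) ^ (J * J))
        = exp (real (3 * r + 2 * J + 1) * ln 2 + real (J * J) * ln (1 + ln x))"
    proof -
      have "(4::real) ^ r = 2 ^ (2 * r)" by (simp add: power_mult)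
      then have "2 ^ (r + 1 + J) * (4 ^ r * 2 ^ J) = (2::real) ^ (3 * r + 2 * J + 1)"
        by (simp add: power_add[symmetric] algebra_simps numeral_eq_Suc)
      moreover have "(2::real) ^ k = exp (real k * ln 2)" for k by (simp add: exp_of_nat_mult)
      moreover have "(1 + ln x) ^ k = exp (real k * ln (1 + ln x))" for k
        using lx by (simp add: exp_of_nat_mult)
      ultimately show ?thesis by (simp only: exp_add mult.assoc[symmetric])
    qed
    also have "\<dots> < exp (5 * L ^ 3)"
    proof -
      have "real (3 * r + 2 * J + 1) * ln 2 \<le> real (3 * r + 2 * J + 1) * 1"
        using ln_le_minus_one[of 2] by (intro mult_left_mono) auto
      also have "\<dots> = 3 * real r + 2 * real J + 1" by simp
      also have "\<dots> \<le> 3 * (R + 1) + 4 * L + 1"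
        using r1(2) JL2 by (intro add_mono) auto
      also have "\<dots> \<le> 3 * ((4 * b + 2 * (2 * L) * L) / ln 2 + 1) + 4 * L + 1"
        by (intro add_mono mult_left_mono order_refl RL) simp
      finally have 1: "real (3 * r + 2 * J + 1) * ln 2 \<le> \<dots>" .
      have 2: "real (J * J) * ln (1 + ln x) \<le> (2 * L) ^ 2 * ln (1 + ln x)"
      proof (rule mult_right_mono)
        show "real (J * J) \<le> (2 * L) ^ 2"
          using power_mono[OF JL2, of 2] by (simp add: power2_eq_square)
        show "0 \<le> ln (1 + ln x)" using lx by simp
      qed
      note add_mono[OF 1 2]
      also have "3 * ((4 * b + 2 * (2 * L) * L) / ln 2 + 1) + 4 * L + 1 + (2 * L) ^ 2 * ln (1 + ln x) < 5 * L ^ 3"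
        using big2 unfolding L_def .
      finally show ?thesis by (simp only: exp_less_cancel_iff)
    qed
    finally have lt: "2 ^ (r + 1 + J) * (4 ^ r * 2 ^ J * (1 + ln x) ^ (J * J)) < exp (5 * L ^ 3)" .
    have pos: "2 ^ (r + 1 + J) * (4 ^ r * 2 ^ J * (1 + ln x) ^ (J * J)) > 0" using lx by simp
    interpret prime_tower B T J r
    proof
      show "B > 1" by (rule B1)
      show "y / ln y ^ 2 \<le> real (card (prime_window y))" if "y \<ge> B" for y
        using B0 that Bb bB by (meson order_trans)
      show "4 * ln y ^ 2 < y" if "y \<ge> B" for y using B0 that Bb bB by (meson order_trans)
      show "T \<ge> 1" by (rule T1)
      show "ln (B ^ 2 ^ j) ^ 2 \<le> T" if "j < J" for j
      proof -
        have "B ^ 2 ^ j \<le> B ^ 2 ^ J" using B1 that by (intro power_increasing) auto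
        then have "ln (B ^ 2 ^ j) \<le> ln X" unfolding BX using Bpos X0 by simp
        moreover have "0 \<le> ln (B ^ 2 ^ j)" using B1 by (intro ln_ge_zero one_le_power) simp
        ultimately show ?thesis unfolding T_def using lX by (intro power_mono) auto
      qed
      have "B \<le> exp (4 * b)" using lnB Bpos by (metis exp_le_cancel_iff exp_ln)
      then have "B * T ^ J \<le> exp (4 * b) * T ^ J" using T1 by (intro mult_right_mono) auto
      with r2 show "B * T ^ J \<le> 2 ^ r" by linarith
    qed
    have sJ: "scale J = X" by (simp add: scale_def BX)
    have "2 ^ (r + 1 + J) * scale J \<le> x" by (simp add: sJ X_def)
    from card_endpoints_ge[OF this]
    have low: "X / (4 ^ r * 2 ^ J * (1 + ln x) ^ (J * J))
        \<le> real (card {m::nat. additive_endpoint m \<and> 1 \<le> m \<and> real m \<le> x})"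
      by (simp add: sJ)
    have "x / exp (5 * L ^ 3) < x / (2 ^ (r + 1 + J) * (4 ^ r * 2 ^ J * (1 + ln x) ^ (J * J)))"
      using lt pos x by (intro divide_strict_left_mono) auto
    also have "\<dots> = X / (4 ^ r * 2 ^ J * (1 + ln x) ^ (J * J))" by (simp add: X_def)
    also note low
    finally show ?thesis unfolding L_def .
  qed
  have "\<forall>\<^sub>F x::real in at_top. x \<ge> 3" by (rule eventually_ge_at_top)
  moreover have "\<forall>\<^sub>F x::real in at_top. ln (ln x) \<ge> 1" by real_asymp
  moreover have "\<forall>\<^sub>F x::real in at_top. 4 * b \<le> ln x" by real_asymp
  moreover have "\<forall>\<^sub>F x::real in at_top.
      (4 * b + 2 * (2 * ln (ln x)) * ln (ln x)) / ln 2 + 2 + 2 * ln (ln x) \<le> ln x / 2" by real_asymp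
  moreover have "\<forall>\<^sub>F x::real in at_top.
      3 * ((4 * b + 2 * (2 * ln (ln x)) * ln (ln x)) / ln 2 + 1) + 4 * ln (ln x) + 1
          + (2 * ln (ln x)) ^ 2 * ln (1 + ln x) < 5 * ln (ln x) ^ 3"
    by real_asymp
  ultimately show ?thesis by eventually_elim (rule main)
qed

theorem theorem1p3:
  shows "(\<forall>A::real. A > 0 \<longrightarrow>
           (\<exists>C::real. C > 0 \<and> (\<forall>x::real. x \<ge> 3 \<longrightarrow>
              real (card {m::nat. additive_endpoint m \<and> 1 \<le> m \<and> real m \<le> x})
                \<le> C * (x / (ln x) powr A))))
       \<and> (\<exists>c\<^sub>5::real. c\<^sub>5 > 0 \<and> (\<forall>\<^sub>F x::real in at_top.
              real (card {m::nat. additive_endpoint m \<and> 1 \<le> m \<and> real m \<le> x})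
                > x / exp (c\<^sub>5 * (ln (ln x)) ^ 3)))"
proof (intro conjI allI impI)
  fix A :: real assume "A > 0"
  then show "\<exists>C::real. C > 0 \<and> (\<forall>x::real. x \<ge> 3 \<longrightarrow>
              real (card {m::nat. additive_endpoint m \<and> 1 \<le> m \<and> real m \<le> x})
                \<le> C * (x / (ln x) powr A))"
    by (rule additive_endpoints_upper)
next
  show "\<exists>c\<^sub>5::real. c\<^sub>5 > 0 \<and> (\<forall>\<^sub>F x::real in at_top.
              real (card {m::nat. additive_endpoint m \<and> 1 \<le> m \<and> real m \<le> x})
                > x / exp (c\<^sub>5 * (ln (ln x)) ^ 3))"
    using additive_endpoints_lower by (intro exI[of _ 5] conjI) simp_all
qed

end
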